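(* Let $(\Omega,\mu)$ be a finite probability space and $f\colon\Omega^n\to\mathbb{R}$. Let $\gamma_2>\gamma_1>0$, $r>1$, and let $d$ be a nonnegative integer with $d\le\frac12\log(\gamma_2/\gamma_1)$. Suppose that for all $S\subseteq[n]$ with $|S|\le d$ and all $x\in\Omega^S$ we have $\|f_{S\to x}\|_1\le r^{|S|}\gamma_1$ and $\|f_{S\to x}\|_2\le r^{|S|}\gamma_2$. Then \[\|f^{=d}\|_2^2\le\gamma_1^2\left(\frac{2200\,r^2\log(\gamma_2/\gamma_1)}{d}\right)^d.\]
   Context: Norms are with respect to the product measure $\mu^n$ (restrictions are normed over the remaining coordinates); $\log$ is natural; convention $(\cdot)^0=1$. $f_{S\to x}(y)=f(x,y)$. For $i\in[n]$, $E_i$ averages over coordinate $i$ according to $\mu$, $L_i=I-E_i$, $E_S=\prod_{i\in S}E_i$, $L_S=\prod_{i\in S}L_i$; $f^{=T}=E_{[n]\setminus T}L_Tf$ and $f^{=d}=\sum_{|T|=d}f^{=T}$. *)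

theory Defs
  imports Complex_Main "HOL-Library.FuncSet"
begin

text \<open>Finite probability space: a finite type 'a with weights mu (nonnegative, summing to 1).
Points of Omega^n are functions nat => 'a; only the coordinates 0..n-1 matter.\<close>

definition prob_weights :: "('a::finite \<Rightarrow> real) \<Rightarrow> bool" where
  "prob_weights mu \<longleftrightarrow> (\<forall>w. mu w \<ge> 0) \<and> (\<Sum>w\<in>UNIV. mu w) = 1"

definition expect :: "('a::finite \<Rightarrow> real) \<Rightarrow> nat \<Rightarrow> ((nat \<Rightarrow> 'a) \<Rightarrow> real) \<Rightarrow> real" where
  "expect mu n g = (\<Sum>x\<in>PiE {..<n} (\<lambda>_. UNIV). (\<Prod>i<n. mu (x i)) * g x)"

definition norm1 :: "('a::finite \<Rightarrow> real) \<Rightarrow> nat \<Rightarrow> ((nat \<Rightarrow> 'a) \<Rightarrow> real) \<Rightarrow> real" where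
  "norm1 mu n g = expect mu n (\<lambda>x. \<bar>g x\<bar>)"

definition norm2 :: "('a::finite \<Rightarrow> real) \<Rightarrow> nat \<Rightarrow> ((nat \<Rightarrow> 'a) \<Rightarrow> real) \<Rightarrow> real" where
  "norm2 mu n g = sqrt (expect mu n (\<lambda>x. (g x)\<^sup>2))"

text \<open>Restriction f_{S->x}, viewed as a function on Omega^n not depending on the coordinates in S.\<close>
definition restr :: "((nat \<Rightarrow> 'a) \<Rightarrow> real) \<Rightarrow> nat set \<Rightarrow> (nat \<Rightarrow> 'a) \<Rightarrow> ((nat \<Rightarrow> 'a) \<Rightarrow> real)" where
  "restr f S x = (\<lambda>y. f (\<lambda>i. if i \<in> S then x i else y i))"

definition Eop :: "('a::finite \<Rightarrow> real) \<Rightarrow> nat \<Rightarrow> ((nat \<Rightarrow> 'a) \<Rightarrow> real) \<Rightarrow> ((nat \<Rightarrow> 'a) \<Rightarrow> real)" where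
  "Eop mu i g = (\<lambda>x. \<Sum>w\<in>UNIV. mu w * g (x(i := w)))"

definition Lop :: "('a::finite \<Rightarrow> real) \<Rightarrow> nat \<Rightarrow> ((nat \<Rightarrow> 'a) \<Rightarrow> real) \<Rightarrow> ((nat \<Rightarrow> 'a) \<Rightarrow> real)" where
  "Lop mu i g = (\<lambda>x. g x - Eop mu i g x)"

definition ESop :: "('a::finite \<Rightarrow> real) \<Rightarrow> nat set \<Rightarrow> ((nat \<Rightarrow> 'a) \<Rightarrow> real) \<Rightarrow> ((nat \<Rightarrow> 'a) \<Rightarrow> real)" where
  "ESop mu S g = foldr (Eop mu) (sorted_list_of_set S) g"

definition LSop :: "('a::finite \<Rightarrow> real) \<Rightarrow> nat set \<Rightarrow> ((nat \<Rightarrow> 'a) \<Rightarrow> real) \<Rightarrow> ((nat \<Rightarrow> 'a) \<Rightarrow> real)" where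
  "LSop mu S g = foldr (Lop mu) (sorted_list_of_set S) g"

definition fpart :: "('a::finite \<Rightarrow> real) \<Rightarrow> nat \<Rightarrow> nat set \<Rightarrow> ((nat \<Rightarrow> 'a) \<Rightarrow> real) \<Rightarrow> ((nat \<Rightarrow> 'a) \<Rightarrow> real)" where
  "fpart mu n T f = ESop mu ({..<n} - T) (LSop mu T f)"

definition flevel :: "('a::finite \<Rightarrow> real) \<Rightarrow> nat \<Rightarrow> nat \<Rightarrow> ((nat \<Rightarrow> 'a) \<Rightarrow> real) \<Rightarrow> ((nat \<Rightarrow> 'a) \<Rightarrow> real)" where
  "flevel mu n d f = (\<lambda>x. \<Sum>T\<in>{T. T \<subseteq> {..<n} \<and> card T = d}. fpart mu n T f x)"

end

theory Submission
  imports Defs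
begin

text \<open>
  Let \<open>T\<^sub>i = E\<^sub>i + \<rho> L\<^sub>i\<close> with \<open>\<rho> = 1 / (4 \<surd>m)\<close>. A pointwise expansion of an \<open>m\<close>-th power gives, one
  coordinate at a time and with values in the Hilbert space of the coordinates in \<open>B\<close>,
  the moment bound
  \<open>E (T f)\<^sup>2\<^sup>m \<le> \<Sum>\<^sub>S (3 m\<^sup>m)\<^bsup>|S|\<^esup> E\<^sub>x \<parallel>(L\<^sub>S f)(x, \<cdot>)\<parallel>\<^sub>2\<^sup>2\<^sup>m\<close>.
  Apply it to \<open>g = f\<^bsup>=d\<^esup>\<close>: the restrictions of \<open>L\<^sub>S g\<close> to the coordinates in \<open>S\<close> are the level \<open>d - |S|\<close>
  parts of derivatives of \<open>f\<close>, which satisfy the hypotheses with \<open>\<gamma>1, \<gamma>2\<close> multiplied by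
  \<open>(2r)\<^bsup>|S|\<^esup>\<close>, so induction on the level bounds them and hence the \<open>2m\<close>-th moment of \<open>g\<close>. Finally
  \<open>\<parallel>g\<parallel>\<^sub>2\<^sup>2 = E f g\<close>, where the contribution of small \<open>g\<close> is controlled by \<open>\<parallel>f\<parallel>\<^sub>1\<close> and that of
  large \<open>g\<close> by \<open>\<parallel>f\<parallel>\<^sub>2\<close> and the moment; \<open>m\<close> is taken about \<open>log (\<gamma>2 / \<gamma>1) / d\<close>.
\<close>

section \<open>Real inequalities\<close>

text \<open>The discriminant criterion in a form that admits the degenerate case
  \<open>a = 0\<close>. It yields Cauchy-Schwarz for partial averages pointwise.\<close>

lemma quadratic_nonneg_discriminant:
  fixes a b c :: real
  assumes "\<And>s. 0 \<le> s\<^sup>2 * a - 2 * s * b + c" "0 \<le> a"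
  shows "b\<^sup>2 \<le> a * c"
proof (cases "a = 0")
  case True
  have "b = 0"
  proof (rule ccontr)
    assume "b \<noteq> 0"
    \<comment> \<open>With \<open>a = 0\<close> the expression is affine in \<open>s\<close>; this
      witness gives it the value -1.\<close>
    then show False using assms(1)[of "(c + 1) / (2 * b)"] True by simp
  qed
  then show ?thesis using True by simp
next
  case False
  with assms(2) have "a > 0" by simp
  \<comment> \<open>The quadratic is minimal at \<open>s = b / a\<close>.\<close>
  have "0 \<le> (b / a)\<^sup>2 * a - 2 * (b / a) * b + c" by (rule assms(1))
  also have "\<dots> = c - b\<^sup>2 / a" using \<open>a > 0\<close> by (simp add: power2_eq_square field_simps)
  finally show ?thesis using \<open>a > 0\<close> by (simp add: field_simps)
qed

lemma exp_le_quadratic: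
  fixes v :: real
  assumes "\<bar>v\<bar> \<le> 1"
  shows "exp v \<le> 1 + v + v\<^sup>2"
proof (cases "v \<ge> 0")
  case True
  then show ?thesis using exp_bound assms by simp
next
  case False
  define x where "x = - v"
  have x: "0 \<le> x" using False by (simp add: x_def)
  have pos: "0 < 1 + x + x\<^sup>2 / 2" using x by (simp add: add_pos_nonneg)
  have "1 + x + x\<^sup>2 / 2 \<le> exp x" by (rule exp_lower_Taylor_quadratic[OF x])
  then have "exp v \<le> 1 / (1 + x + x\<^sup>2 / 2)"
    using pos by (simp add: x_def exp_minus field_simps)
  also have "\<dots> \<le> 1 - x + x\<^sup>2"
  proof -
    have "(1 - x + x\<^sup>2) * (1 + x + x\<^sup>2 / 2) = 1 + x\<^sup>2 / 2 + x ^ 3 / 2 + x ^ 4 / 2"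
      by (simp add: power2_eq_square power3_eq_cube power4_eq_xxxx field_simps)
    also have "\<dots> \<ge> 1" using x by simp
    finally show ?thesis using pos by (simp add: divide_le_eq)
  qed
  finally show ?thesis by (simp add: x_def)
qed

text \<open>Bernoulli's inequality in homogeneous form, so that \<open>a = 0\<close> is covered. It
  later folds a first-order term back into an \<open>m\<close>-th power with constant one.\<close>

lemma power_add_ge_linear:
  fixes a s :: real
  assumes "0 \<le> a" "0 \<le> s"
  shows "a ^ m + real m * a ^ (m - 1) * s \<le> (a + s) ^ m"
proof (induction m)
  case (Suc m)
  have "a ^ Suc m + real (Suc m) * a ^ m * s \<le> (a ^ m + real m * a ^ (m - 1) * s) * (a + s)"
    using assms by (cases m) (simp_all add: algebra_simps)
  also have "\<dots> \<le> (a + s) ^ m * (a + s)"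
    using Suc assms by (intro mult_right_mono) auto
  finally show ?case by (simp add: mult.commute)
qed simp

text \<open>Think of \<open>a\<close> and \<open>t\<close> as squared norms of two vectors and of
  \<open>U\<close> as their inner product: the left side is then the \<open>m\<close>-th power of
  the squared norm of the first vector plus \<open>\<rho>\<close> times the second. The term linear
  in \<open>U\<close> is kept exactly because it averages to zero later. If
  \<open>m t \<le> a\<close>, the power is compared with an exponential expanded to second order;
  otherwise both the power and the linear term are dominated by multiples of
  \<open>(m t)^m\<close>.\<close>

lemma power_perturbation_bound:
  fixes a t U \<rho> :: real
  assumes m: "m \<ge> 1" and \<rho>: "\<rho> = 1 / (4 * sqrt (real m))"
    and a: "0 \<le> a" and t: "0 \<le> t" and U: "U\<^sup>2 \<le> a * t"
    and nonneg: "0 \<le> a + 2 * \<rho> * U + \<rho>\<^sup>2 * t"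
  shows "(a + 2 * \<rho> * U + \<rho>\<^sup>2 * t) ^ m
    \<le> a ^ m + 2 * real m * \<rho> * U * a ^ (m - 1) + real m * t * a ^ (m - 1)
      + 3 * real m ^ m * t ^ m"
proof -
  have m0: "real m > 0" using m by simp
  have \<rho>2: "\<rho>\<^sup>2 = 1 / (16 * real m)"
    using m0 by (simp add: \<rho> power_divide power_mult_distrib)
  have am: "a ^ m = a ^ (m - 1) * a"
    using m by (metis One_nat_def Suc_diff_le diff_Suc_1 power_Suc2)
  show ?thesis
  proof (cases "real m * t \<le> a")
    case True
    show ?thesis
    proof (cases "a = 0")
      case True
      then have "t = 0" using \<open>real m * t \<le> a\<close> t m0 by (simp add: mult_le_0_iff)
      moreover have "U = 0" using U True by simp
      ultimately show ?thesis using True m by simp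
    next
      case False
      with a have a0: "a > 0" by simp
      \<comment> \<open>Up to the factor \<open>m / a\<close>, \<open>p\<close> is the linear and
        \<open>q\<close> the quadratic perturbation, so the base equals
        \<open>a (1 + (p + q) / m)\<close>. Both are measured against
        \<open>z \<le> 1\<close>.\<close>
      define z where "z = real m * t / a"
      define p where "p = 2 * real m * \<rho> * U / a"
      define q where "q = t / (16 * a)"
      have z: "0 \<le> z" "z \<le> 1" using \<open>real m * t \<le> a\<close> t a0 by (simp_all add: z_def)
      have p2: "p\<^sup>2 \<le> z / 4"
      proof -
        have "p\<^sup>2 = real m * U\<^sup>2 / (4 * a\<^sup>2)"
          using m0 by (simp add: p_def power_divide power_mult_distrib \<rho>2) (simp add: power2_eq_square)
        also have "\<dots> \<le> real m * (a * t) / (4 * a\<^sup>2)"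
          using U m0 a0 by (intro divide_right_mono mult_left_mono) auto
        also have "\<dots> = z / 4" using a0 by (simp add: z_def power2_eq_square)
        finally show ?thesis .
      qed
      have q: "0 \<le> q" "q \<le> z / 16"
        using t a0 m mult_left_mono[of 1 "real m" t] by (auto simp: q_def z_def field_simps)
      have q2: "q\<^sup>2 \<le> z / 256"
      proof -
        have "q\<^sup>2 \<le> (z / 16)\<^sup>2" using q by (intro power_mono) auto
        also have "\<dots> \<le> z / 256" using z by (simp add: power2_eq_square mult_left_le)
        finally show ?thesis .
      qed
      have v2: "(p + q)\<^sup>2 \<le> 85 * z / 256"
      proof -
        \<comment> \<open>This weighting of the cross term gives \<open>5/4 p^2 + 5 q^2\<close>, at
          most \<open>85 z / 256\<close>. Together with \<open>q \<le> z / 16\<close> it stays below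
          \<open>z\<close>, which is all that the second-order expansion may cost.\<close>
        have "0 \<le> (p / 2 - 2 * q)\<^sup>2" by simp
        then have "(p + q)\<^sup>2 \<le> 5 / 4 * p\<^sup>2 + 5 * q\<^sup>2"
          by (simp add: power2_eq_square algebra_simps)
        then show ?thesis using p2 q2 by simp
      qed
      then have v1: "\<bar>p + q\<bar> \<le> 1" using z by (intro power2_le_iff_abs_le[THEN iffD1]) auto
      have w: "a + 2 * \<rho> * U + \<rho>\<^sup>2 * t = a * (1 + (p + q) / real m)"
        using a0 m0 by (simp add: p_def q_def \<rho>2 field_simps)
      have "(a + 2 * \<rho> * U + \<rho>\<^sup>2 * t) ^ m = a ^ m * (1 + (p + q) / real m) ^ m"
        by (simp add: w power_mult_distrib)
      also have "\<dots> \<le> a ^ m * exp (p + q)"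
      proof (intro mult_left_mono)
        have "0 \<le> 1 + (p + q) / real m"
          using nonneg a0 unfolding w by (simp add: zero_le_mult_iff)
        then have "(1 + (p + q) / real m) ^ m \<le> exp ((p + q) / real m) ^ m"
          by (intro power_mono) (auto simp: exp_ge_add_one_self)
        also have "\<dots> = exp (p + q)"
          using m0 by (simp flip: exp_of_nat_mult)
        finally show "(1 + (p + q) / real m) ^ m \<le> exp (p + q)" .
      qed (use a in simp)
      also have "\<dots> \<le> a ^ m * (1 + p + z)"
        using exp_le_quadratic[OF v1] v2 q z a by (intro mult_left_mono) auto
      also have "\<dots> = a ^ m + 2 * real m * \<rho> * U * a ^ (m - 1) + real m * t * a ^ (m - 1)"
        using a0 by (simp add: am p_def z_def field_simps)
      also have "\<dots> \<le> \<dots> + 3 * real m ^ m * t ^ m" using t by simp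
      finally show ?thesis .
    qed
  next
    case False
    then have at: "a \<le> real m * t" and t0: "t > 0"
      using a t by (auto intro: le_less_trans simp: less_le)
    have \<rho>U: "\<bar>\<rho> * U\<bar> \<le> t / 4"
    proof (rule power2_le_imp_le)
      have "(\<rho> * U)\<^sup>2 \<le> 1 / (16 * real m) * (real m * t * t)"
        unfolding power_mult_distrib \<rho>2 using U at t m0
        by (intro mult_left_mono order_trans[OF U] mult_right_mono) auto
      also have "\<dots> = (t / 4)\<^sup>2" using m0 by (simp add: power2_eq_square)
      finally show "\<bar>\<rho> * U\<bar>\<^sup>2 \<le> (t / 4)\<^sup>2" by simp
    qed (use t in simp)
    \<comment> \<open>The cross term adds at most \<open>t / 2\<close> and the quadratic term at
      most \<open>t / 16\<close>, hence the 9/16.\<close>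
    have "a + 2 * \<rho> * U + \<rho>\<^sup>2 * t \<le> real m * t * (1 + (9 / 16) / real m)"
    proof -
      have "\<rho>\<^sup>2 * t \<le> t / 16" using m t by (simp add: \<rho>2 field_simps mult_le_cancel_left1)
      then have "a + 2 * \<rho> * U + \<rho>\<^sup>2 * t \<le> real m * t + t / 2 + t / 16" using at \<rho>U by linarith
      also have "\<dots> = real m * t * (1 + (9 / 16) / real m)" using m0 by (simp add: field_simps)
      finally show ?thesis .
    qed
    then have "(a + 2 * \<rho> * U + \<rho>\<^sup>2 * t) ^ m \<le> (real m * t * (1 + (9 / 16) / real m)) ^ m"
      using nonneg by (rule power_mono)
    also have "\<dots> = (real m * t) ^ m * (1 + (9 / 16) / real m) ^ m"
      by (simp add: power_mult_distrib)
    also have "\<dots> \<le> (real m * t) ^ m * exp ((9 / 16) / real m) ^ m"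
      using t m0 by (intro mult_left_mono power_mono) (auto simp: exp_ge_add_one_self)
    also have "exp ((9 / 16) / real m) ^ m = exp (9 / 16 :: real)"
      using m0 by (simp flip: exp_of_nat_mult)
    also have "(real m * t) ^ m * exp (9 / 16 :: real) \<le> (real m * t) ^ m * 2"
      using exp_le_quadratic[of "9 / 16"] t by (intro mult_left_mono) (auto simp: power2_eq_square)
    finally have main: "(a + 2 * \<rho> * U + \<rho>\<^sup>2 * t) ^ m \<le> 2 * (real m * t) ^ m" by simp
    \<comment> \<open>The linear term on the right may be negative, but by at most half of
      \<open>(m t)^m\<close>. With the factor 2 from \<open>main\<close> this fits under the
      coefficient 3.\<close>
    have "- (2 * real m * \<rho> * U * a ^ (m - 1)) = (2 * real m) * - (\<rho> * U) * a ^ (m - 1)" by simp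
    also have "\<dots> \<le> (2 * real m) * (t / 4) * (real m * t) ^ (m - 1)"
      using \<rho>U at a t by (intro mult_mono[OF mult_left_mono] power_mono) auto
    also have "\<dots> = (real m * t) ^ m / 2"
      using m by (cases m) auto
    finally have "- (2 * real m * \<rho> * U * a ^ (m - 1)) \<le> (real m * t) ^ m / 2" .
    moreover have "0 \<le> a ^ m" "0 \<le> real m * t * a ^ (m - 1)" "0 \<le> (real m * t) ^ m"
      using a t by auto
    ultimately show ?thesis using main by (simp add: power_mult_distrib)
  qed
qed

text \<open>Lets the gain 8 per derivative absorb the cost \<open>3 m^m\<close> of a differentiated
  coordinate. The bound starts at \<open>m = 2\<close>, where it reads 6 against 8.\<close>

lemma three_times_le_power_8: "m \<ge> 2 \<Longrightarrow> 3 * real m \<le> 8 ^ (m - 1)"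
proof (induction m rule: nat_induct_at_least)
  case (Suc m)
  then have "8 * (3 * real m) \<le> 8 * 8 ^ (m - 1)" by simp
  also have "\<dots> = 8 ^ m" using Suc.hyps by (simp flip: power_Suc)
  finally show ?case using Suc.hyps by simp
qed simp

text \<open>Where \<open>g\<close> is at most \<open>\<tau>\<close> in absolute value the first
  summand suffices; elsewhere the factor \<open>(\<bar>g\<bar> / \<tau>)^(m - 1)\<close> is at least
  one and may be inserted, giving the second.\<close>

lemma abs_mult_le_truncation:
  fixes f g \<tau> :: real
  assumes "\<tau> > 0" "m \<ge> 1"
  shows "f * g \<le> \<tau> * \<bar>f\<bar> + (1 / \<tau> ^ (m - 1)) * (\<bar>f\<bar> * \<bar>g\<bar> ^ m)"
proof (cases "\<bar>g\<bar> \<le> \<tau>")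
  case True
  have "f * g \<le> \<bar>f\<bar> * \<bar>g\<bar>" by (simp flip: abs_mult)
  also have "\<dots> \<le> \<bar>f\<bar> * \<tau>" using True by (intro mult_left_mono) auto
  also have "\<dots> \<le> \<tau> * \<bar>f\<bar> + (1 / \<tau> ^ (m - 1)) * (\<bar>f\<bar> * \<bar>g\<bar> ^ m)"
    using assms by (simp add: mult.commute)
  finally show ?thesis .
next
  case False
  have "f * g \<le> \<bar>f\<bar> * \<bar>g\<bar> * 1" by (simp flip: abs_mult)
  also have "\<dots> \<le> \<bar>f\<bar> * \<bar>g\<bar> * (\<bar>g\<bar> / \<tau>) ^ (m - 1)"
    using False assms by (intro mult_left_mono one_le_power) auto
  also have "\<dots> = (1 / \<tau> ^ (m - 1)) * (\<bar>f\<bar> * \<bar>g\<bar> ^ m)"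
    using assms(2) by (cases m) (simp_all add: power_divide)
  also have "\<dots> \<le> \<tau> * \<bar>f\<bar> + (1 / \<tau> ^ (m - 1)) * (\<bar>f\<bar> * \<bar>g\<bar> ^ m)"
    using assms by simp
  finally show ?thesis .
qed

section \<open>Averaging operators and expectations\<close>

text \<open>A single fold for averages, Laplacians and noise operators, so that the rules for
  commuting families are proved once. It unfolds to the same term as \<open>ESop\<close> and
  \<open>LSop\<close>.\<close>

definition opS :: "(nat \<Rightarrow> 'b \<Rightarrow> 'b) \<Rightarrow> nat set \<Rightarrow> 'b \<Rightarrow> 'b" where
  "opS F S g = foldr F (sorted_list_of_set S) g"

lemma opS_empty [simp]: "opS F {} g = g"
  by (simp add: opS_def)

lemma foldr_insort_commuting:
  assumes "\<And>i j g. F i (F j g) = F j (F i g)"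
  shows "foldr F (insort i xs) g = F i (foldr F xs g)"
  by (induction xs) (auto simp: assms)

lemma opS_insert:
  assumes "\<And>i j g. F i (F j g) = F j (F i g)" "finite S" "i \<notin> S"
  shows "opS F (insert i S) g = F i (opS F S g)"
  using assms(2,3) by (simp add: opS_def foldr_insort_commuting[of F, OF assms(1)])

lemma opS_commute_apply:
  assumes "finite S" "\<And>j g. j \<in> S \<Longrightarrow> H (F j g) = G j (H g)"
  shows "H (opS F S g) = opS G S (H g)"
proof -
  have "set xs \<subseteq> S \<Longrightarrow> H (foldr F xs g) = foldr G xs (H g)" for xs
    by (induction xs) (auto simp: assms(2))
  then show ?thesis using assms(1) by (simp add: opS_def)
qed

lemma opS_Un:
  assumes "\<And>i j g. F i (F j g) = F j (F i g)" "finite S" "finite S'" "S \<inter> S' = {}"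
  shows "opS F (S \<union> S') g = opS F S (opS F S' g)"
  using assms(2,4)
proof (induction S rule: finite_induct)
  case (insert i S)
  then show ?case
    using assms(3) by (simp add: opS_insert[of F, OF assms(1)])
qed simp

lemma opS_invariant:
  assumes "finite S" "P g" "\<And>i g. i \<in> S \<Longrightarrow> P g \<Longrightarrow> P (F i g)"
  shows "P (opS F S g)"
proof -
  have "set xs \<subseteq> S \<Longrightarrow> P (foldr F xs g)" for xs
    by (induction xs) (auto simp: assms)
  then show ?thesis using assms(1) by (simp add: opS_def)
qed

section \<open>Functions that do not depend on a coordinate\<close>

definition indep :: "nat \<Rightarrow> ((nat \<Rightarrow> 'a) \<Rightarrow> real) \<Rightarrow> bool" where
  "indep i g \<longleftrightarrow> (\<forall>x w. g (x(i := w)) = g x)"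

text \<open>The two points are joined by changing one coordinate of \<open>B\<close> at a
  time.\<close>

lemma indep_agree:
  assumes "finite B" "\<And>i. i \<in> B \<Longrightarrow> indep i g" "\<And>i. i \<notin> B \<Longrightarrow> x i = y i"
  shows "g x = g y"
  using assms
proof (induction B arbitrary: x rule: finite_induct)
  case empty
  then have "x = y" by auto
  then show ?case by simp
next
  case (insert i B)
  have "g (x(i := y i)) = g y"
    by (rule insert.IH) (use insert.prems in auto)
  moreover have "g (x(i := y i)) = g x"
    using insert.prems(1)[of i] by (simp add: indep_def)
  ultimately show ?case by simp
qed

lemma indep_restr: "i \<in> S \<Longrightarrow> indep i (restr f S x)"
  by (auto simp: indep_def restr_def intro!: arg_cong[of _ _ f])

lemma restr_empty [simp]: "restr f {} x = f"
  by (simp add: restr_def)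

lemma indep_power2: "indep i g \<Longrightarrow> indep i (\<lambda>x. (g x)\<^sup>2)"
  by (simp add: indep_def)

section \<open>Algebra of the operators E, L and the noise operator\<close>

locale finite_prob =
  fixes mu :: "'a::finite \<Rightarrow> real"
  assumes prob_weights: "prob_weights mu"
begin

abbreviation "E \<equiv> Eop mu"
abbreviation "L \<equiv> Lop mu"
abbreviation "ES \<equiv> opS E"
abbreviation "LS \<equiv> opS L"

text \<open>The usual noise operator: it equals \<open>\<rho>\<close> times the identity plus
  \<open>1 - \<rho>\<close> times the average over coordinate \<open>i\<close>.\<close>

definition Top :: "real \<Rightarrow> nat \<Rightarrow> ((nat \<Rightarrow> 'a) \<Rightarrow> real) \<Rightarrow> ((nat \<Rightarrow> 'a) \<Rightarrow> real)" where
  "Top \<rho> i g = (\<lambda>x. E i g x + \<rho> * L i g x)"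

abbreviation "TS \<rho> \<equiv> opS (Top \<rho>)"

lemma ESop_eq: "ESop mu = ES" and LSop_eq: "LSop mu = LS"
  by (auto simp: ESop_def LSop_def opS_def fun_eq_iff)

lemma mu_nonneg [simp]: "mu w \<ge> 0" and mu_sum [simp]: "(\<Sum>w\<in>UNIV. mu w) = 1"
  using prob_weights by (auto simp: prob_weights_def)

lemma Eop_commute: "E i (E j g) = E j (E i g)"
proof (cases "i = j")
  case False
  have "E i (E j g) x = E j (E i g) x" for x
    unfolding Eop_def sum_distrib_left
    by (subst sum.swap) (simp add: fun_upd_twist[OF False] mult.left_commute)
  then show ?thesis by auto
qed simp

lemma Eop_add: "E i (\<lambda>x. g x + h x) = (\<lambda>x. E i g x + E i h x)"
  and Eop_diff: "E i (\<lambda>x. g x - h x) = (\<lambda>x. E i g x - E i h x)"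
  and Eop_scale: "E i (\<lambda>x. c * g x) = (\<lambda>x. c * E i g x)"
  by (auto simp: Eop_def fun_eq_iff algebra_simps sum.distrib sum_subtractf sum_distrib_left)

lemma Eop_sum: "E i (\<lambda>x. \<Sum>T\<in>A. h T x) = (\<lambda>x. \<Sum>T\<in>A. E i (h T) x)"
  by (rule ext) (simp add: Eop_def sum_distrib_left, rule sum.swap)

lemma Eop_indep: "indep i g \<Longrightarrow> E i g = g"
  by (auto simp: Eop_def indep_def fun_eq_iff simp flip: sum_distrib_right)

lemma indep_Eop: "indep i (E i g)"
  by (simp add: indep_def Eop_def)

lemma Eop_idem [simp]: "E i (E i g) = E i g"
  by (simp add: Eop_indep indep_Eop)

lemma indep_Eop_other: "indep j g \<Longrightarrow> indep j (E i g)"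
  by (cases "i = j") (auto simp: indep_Eop, auto simp: indep_def Eop_def fun_upd_twist[of j i])

lemma Eop_mult_indep: "indep i a \<Longrightarrow> E i (\<lambda>x. a x * g x) = (\<lambda>x. a x * E i g x)"
  by (auto simp: Eop_def indep_def fun_eq_iff sum_distrib_left mult.left_commute)

lemma Eop_mono: "(\<And>x. g x \<le> h x) \<Longrightarrow> E i g x \<le> E i h x"
  by (simp add: Eop_def sum_mono mult_left_mono)

lemma Eop_Lop: "E i (L j g) = L j (E i g)"
  by (simp add: Lop_def Eop_diff Eop_commute)

lemma Eop_Lop_same: "E i (L i g) = (\<lambda>x. 0)"
  by (simp add: Lop_def Eop_diff)

lemma Lop_diff: "L i (\<lambda>x. g x - h x) = (\<lambda>x. L i g x - L i h x)"
  and Lop_scale: "L i (\<lambda>x. c * g x) = (\<lambda>x. c * L i g x)"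
  and Lop_add: "L i (\<lambda>x. g x + h x) = (\<lambda>x. L i g x + L i h x)"
  by (auto simp: Lop_def Eop_diff Eop_scale Eop_add algebra_simps fun_eq_iff)

lemma Lop_commute: "L i (L j g) = L j (L i g)"
proof -
  have "L i (L j g) = (\<lambda>x. L j g x - L j (E i g) x)"
    by (simp add: Lop_def[of mu i] Eop_Lop)
  also have "\<dots> = L j (L i g)"
    by (simp add: Lop_def[of mu i] Lop_diff)
  finally show ?thesis .
qed

lemma Top_Lop: "Top \<rho> i (L j g) = L j (Top \<rho> i g)"
  by (simp add: Top_def Lop_add Lop_scale Eop_Lop Lop_commute[of i j])

lemma Top_commute: "Top \<rho> i (Top \<rho> j g) = Top \<rho> j (Top \<rho> i g)"
proof -
  have "Top \<rho> i (Top \<rho> j g)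
      = (\<lambda>x. E i (E j g) x + \<rho> * E i (L j g) x + \<rho> * (L i (E j g) x + \<rho> * L i (L j g) x))" for i j
    by (simp add: Top_def Lop_add Lop_scale Eop_add Eop_scale)
  then show ?thesis
    by (simp add: Eop_Lop Eop_commute[of i j] Lop_commute[of i j] algebra_simps)
qed

lemma Lop_indep: "indep i g \<Longrightarrow> L i g = (\<lambda>x. 0)"
  by (simp add: Lop_def Eop_indep)

lemma E_zero [simp]: "E i (\<lambda>x. 0) = (\<lambda>x. 0)" and L_zero [simp]: "L i (\<lambda>x. 0) = (\<lambda>x. 0)"
  by (simp_all add: Eop_def Lop_def)

lemmas ES_insert = opS_insert[of E, OF Eop_commute]
lemmas LS_insert = opS_insert[of L, OF Lop_commute]
lemmas TS_insert = opS_insert[of "Top \<rho>" for \<rho>, OF Top_commute]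
lemmas ES_Un = opS_Un[of E, OF Eop_commute]
lemmas LS_Un = opS_Un[of L, OF Lop_commute]

lemma ES_Eop: "finite B \<Longrightarrow> E i (ES B g) = ES B (E i g)"
  by (rule opS_commute_apply[where H = "E i"]) (simp_all add: Eop_commute)

lemma LS_Lop: "finite B \<Longrightarrow> L i (LS B g) = LS B (L i g)"
  by (rule opS_commute_apply[where H = "L i"]) (simp_all add: Lop_commute)

lemma TS_Lop: "finite B \<Longrightarrow> L i (TS \<rho> B g) = TS \<rho> B (L i g)"
  by (rule opS_commute_apply[where H = "L i"]) (simp_all add: Top_Lop)

lemma ES_add: "finite B \<Longrightarrow> ES B (\<lambda>x. g x + h x) = (\<lambda>x. ES B g x + ES B h x)"
  by (induction B rule: finite_induct) (auto simp: ES_insert Eop_add)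

lemma ES_scale: "finite B \<Longrightarrow> ES B (\<lambda>x. c * g x) = (\<lambda>x. c * ES B g x)"
  by (induction B rule: finite_induct) (auto simp: ES_insert Eop_scale)

lemma ES_zero [simp]: "finite B \<Longrightarrow> ES B (\<lambda>x. 0) = (\<lambda>x. 0)"
  by (induction B rule: finite_induct) (auto simp: ES_insert)

lemma LS_zero [simp]: "finite B \<Longrightarrow> LS B (\<lambda>x. 0) = (\<lambda>x. 0)"
  by (induction B rule: finite_induct) (auto simp: LS_insert)

lemma ES_mono: "finite B \<Longrightarrow> (\<And>x. g x \<le> h x) \<Longrightarrow> ES B g x \<le> ES B h x"
  by (induction B arbitrary: x rule: finite_induct) (auto simp: ES_insert intro: Eop_mono)

lemma ES_nonneg: "finite B \<Longrightarrow> (\<And>x. 0 \<le> g x) \<Longrightarrow> 0 \<le> ES B g x"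
  using ES_mono[of B "\<lambda>x. 0" g x] by simp

lemma indep_ES: "finite B \<Longrightarrow> i \<in> B \<Longrightarrow> indep i (ES B g)"
  using ES_insert[of "B - {i}" i g] by (simp add: insert_absorb indep_Eop)

lemma indep_ES_other: "finite B \<Longrightarrow> indep i g \<Longrightarrow> indep i (ES B g)"
  by (rule opS_invariant[where P = "indep i"]) (auto intro: indep_Eop_other)

lemma ES_indep: "finite B \<Longrightarrow> (\<And>i. i \<in> B \<Longrightarrow> indep i g) \<Longrightarrow> ES B g = g"
  by (induction B rule: finite_induct) (auto simp: ES_insert Eop_indep)

lemma ES_Eop_absorb: "finite B \<Longrightarrow> i \<in> B \<Longrightarrow> ES B (E i g) = ES B g"
  by (metis ES_Eop Eop_indep indep_ES)

lemma ES_Cauchy_Schwarz: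
  assumes "finite B"
  shows "(ES B (\<lambda>x. g x * h x) x)\<^sup>2 \<le> ES B (\<lambda>x. (g x)\<^sup>2) x * ES B (\<lambda>x. (h x)\<^sup>2) x"
proof (rule quadratic_nonneg_discriminant)
  fix s :: real
  have "0 \<le> ES B (\<lambda>x. (s * g x - h x)\<^sup>2) x"
    by (intro ES_nonneg assms) simp
  also have "(\<lambda>x. (s * g x - h x)\<^sup>2)
      = (\<lambda>x. s\<^sup>2 * (g x)\<^sup>2 + ((- 2 * s) * (g x * h x) + (h x)\<^sup>2))"
    by (auto simp: power2_eq_square algebra_simps)
  finally show "0 \<le> s\<^sup>2 * ES B (\<lambda>x. (g x)\<^sup>2) x - 2 * s * ES B (\<lambda>x. g x * h x) x
      + ES B (\<lambda>x. (h x)\<^sup>2) x"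
    using assms by (simp add: ES_add ES_scale del: power_mult_distrib mult_minus_left)
next
  show "0 \<le> ES B (\<lambda>x. (g x)\<^sup>2) x"
    by (intro ES_nonneg assms) simp
qed

text \<open>Averaging one coordinate after another sums over \<open>PiE\<close>. The base point is
  the constant \<open>undefined\<close> because extensional functions take that value at every
  coordinate that is not averaged.\<close>

lemma expect_eq_ES: "expect mu n g = ES {..<n} g (\<lambda>_. undefined)"
proof -
  have "finite A \<Longrightarrow> (\<Sum>x\<in>PiE A (\<lambda>_. UNIV). (\<Prod>i\<in>A. mu (x i)) * g x) = ES A g (\<lambda>_. undefined)"
    for A g
  proof (induction A arbitrary: g rule: finite_induct)
    case (insert i A)
    have inj: "inj_on (\<lambda>(w, x). x(i := w)) (UNIV \<times> PiE A (\<lambda>_. UNIV :: 'a set))"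
      using insert.hyps by (intro inj_combinator) simp
    have "(\<Sum>x\<in>PiE (insert i A) (\<lambda>_. UNIV). (\<Prod>k\<in>insert i A. mu (x k)) * g x)
        = (\<Sum>(w, x)\<in>UNIV \<times> PiE A (\<lambda>_. UNIV). (\<Prod>k\<in>insert i A. mu ((x(i := w)) k)) * g (x(i := w)))"
      unfolding PiE_insert_eq by (subst sum.reindex[OF inj]) (simp add: case_prod_unfold)
    also have "\<dots> = (\<Sum>w\<in>UNIV. \<Sum>x\<in>PiE A (\<lambda>_. UNIV). mu w * (\<Prod>k\<in>A. mu (x k)) * g (x(i := w)))"
      unfolding sum.cartesian_product
    proof (rule sum.cong[OF refl], clarify)
      fix w :: 'a and x :: "nat \<Rightarrow> 'a"
      have "(\<Prod>k\<in>A. mu ((x(i := w)) k)) = (\<Prod>k\<in>A. mu (x k))"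
        using insert.hyps by (intro prod.cong) auto
      then show "(\<Prod>k\<in>insert i A. mu ((x(i := w)) k)) * g (x(i := w))
          = mu w * (\<Prod>k\<in>A. mu (x k)) * g (x(i := w))"
        using insert.hyps by simp
    qed
    also have "\<dots> = (\<Sum>x\<in>PiE A (\<lambda>_. UNIV). (\<Prod>k\<in>A. mu (x k)) * E i g x)"
      by (subst sum.swap) (simp add: Eop_def sum_distrib_left mult_ac)
    also have "\<dots> = ES (insert i A) g (\<lambda>_. undefined)"
      using insert.hyps by (simp add: insert.IH ES_insert ES_Eop)
    finally show ?case .
  qed simp
  from this[of "{..<n}" g] show ?thesis by (simp add: expect_def)
qed

lemma expect_mono_PiE:
  "(\<And>x. x \<in> PiE {..<n} (\<lambda>_. UNIV) \<Longrightarrow> g x \<le> h x) \<Longrightarrow> expect mu n g \<le> expect mu n h"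
  unfolding expect_def by (intro sum_mono mult_left_mono) (auto intro: prod_nonneg)

lemma expect_mono: "(\<And>x. g x \<le> h x) \<Longrightarrow> expect mu n g \<le> expect mu n h"
  by (rule expect_mono_PiE)

lemma expect_nonneg: "(\<And>x. 0 \<le> g x) \<Longrightarrow> 0 \<le> expect mu n g"
  by (simp add: expect_eq_ES ES_nonneg)

lemma expect_add: "expect mu n (\<lambda>x. g x + h x) = expect mu n g + expect mu n h"
  and expect_scale: "expect mu n (\<lambda>x. c * g x) = c * expect mu n g"
  by (simp_all add: expect_eq_ES ES_add ES_scale)

lemma expect_const [simp]: "expect mu n (\<lambda>x. c) = c"
  by (simp add: expect_eq_ES ES_indep indep_def)

lemma expect_sum: "expect mu n (\<lambda>x. \<Sum>T\<in>A. h T x) = (\<Sum>T\<in>A. expect mu n (h T))"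
  unfolding expect_def sum_distrib_left by (rule sum.swap)

lemma expect_Eop: "i < n \<Longrightarrow> expect mu n (E i g) = expect mu n g"
  by (simp add: expect_eq_ES ES_Eop_absorb)

lemma expect_ES: "B \<subseteq> {..<n} \<Longrightarrow> expect mu n (ES B g) = expect mu n g"
proof -
  assume B: "B \<subseteq> {..<n}"
  then have "finite B" by (rule finite_subset) simp
  then show ?thesis using B
    by (induction B rule: finite_induct) (auto simp: ES_insert expect_Eop)
qed

lemma expect_Cauchy_Schwarz:
  "(expect mu n (\<lambda>x. g x * h x))\<^sup>2 \<le> expect mu n (\<lambda>x. (g x)\<^sup>2) * expect mu n (\<lambda>x. (h x)\<^sup>2)"
  by (simp add: expect_eq_ES ES_Cauchy_Schwarz)

lemma norm2_sq: "(norm2 mu n g)\<^sup>2 = expect mu n (\<lambda>x. (g x)\<^sup>2)"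
  by (simp add: norm2_def expect_nonneg)

lemma norm2_nonneg: "0 \<le> norm2 mu n g"
  by (simp add: norm2_def expect_nonneg)

section \<open>Restrictions commute with operators on the other coordinates\<close>

lemma Eop_restr: "i \<notin> S \<Longrightarrow> E i (restr f S x) = restr (E i f) S x"
proof
  fix y assume "i \<notin> S"
  then have "(\<lambda>k. if k \<in> S then x k else (y(i := w)) k) = (\<lambda>k. if k \<in> S then x k else y k)(i := w)" for w
    by auto
  then show "E i (restr f S x) y = restr (E i f) S x y"
    by (simp only: Eop_def restr_def)
qed

lemma Lop_restr: "i \<notin> S \<Longrightarrow> L i (restr f S x) = restr (L i f) S x"
proof
  fix y assume "i \<notin> S"
  then show "L i (restr f S x) y = restr (L i f) S x y"
    by (simp add: Lop_def Eop_restr) (simp add: restr_def)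
qed

lemma ES_restr: "finite B \<Longrightarrow> B \<inter> S = {} \<Longrightarrow> ES B (restr f S x) = restr (ES B f) S x"
  by (induction B rule: finite_induct) (auto simp: ES_insert Eop_restr)

lemma LS_restr: "finite B \<Longrightarrow> B \<inter> S = {} \<Longrightarrow> LS B (restr f S x) = restr (LS B f) S x"
  by (induction B rule: finite_induct) (auto simp: LS_insert Lop_restr)

text \<open>The norm of a restriction is thus a partial average evaluated at \<open>x\<close>.
  Membership in \<open>PiE\<close> makes \<open>x\<close> agree with the base point of the
  expectation beyond \<open>n\<close>; the coordinates below \<open>n\<close> outside
  \<open>S\<close> are averaged away.\<close>

lemma expect_restr:
  assumes "S \<subseteq> {..<n}" "x \<in> PiE {..<n} (\<lambda>_. UNIV)"
  shows "expect mu n (restr g S x) = ES ({..<n} - S) g x"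
proof -
  have fin: "finite S" using assms(1) finite_subset by blast
  have "ES {..<n} (restr g S x) = ES ({..<n} - S) (ES S (restr g S x))"
    using ES_Un[of "{..<n} - S" S "restr g S x"] assms(1) fin
    by (simp add: Un_absorb2 Int_commute)
  also have "\<dots> = restr (ES ({..<n} - S) g) S x"
    using fin by (simp add: ES_indep indep_restr ES_restr Diff_Int_distrib2)
  finally have "expect mu n (restr g S x) = ES ({..<n} - S) g (\<lambda>i. if i \<in> S then x i else undefined)"
    by (simp add: expect_eq_ES restr_def)
  also have "\<dots> = ES ({..<n} - S) g x"
  proof (rule indep_agree[of "{..<n} - S" "ES ({..<n} - S) g"])
    show "(if i \<in> S then x i else undefined) = x i" if "i \<notin> {..<n} - S" for i
      using that PiE_arb[OF assms(2), of i] by (cases "i \<in> S") simp_all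
  qed (simp_all add: indep_ES)
  finally show ?thesis .
qed

section \<open>The hypercontractive moment bound\<close>

lemma ES_square_sum:
  assumes "finite B"
  shows "ES B (\<lambda>y. (g y + c * h y)\<^sup>2) x = ES B (\<lambda>y. (g y)\<^sup>2) x
    + 2 * c * ES B (\<lambda>y. g y * h y) x + c\<^sup>2 * ES B (\<lambda>y. (h y)\<^sup>2) x"
proof -
  have "(\<lambda>y. (g y + c * h y)\<^sup>2) = (\<lambda>y. ((g y)\<^sup>2 + (2 * c) * (g y * h y)) + c\<^sup>2 * (h y)\<^sup>2)"
    by (simp add: power2_eq_square algebra_simps)
  then show ?thesis by (simp only: ES_add[OF assms] ES_scale[OF assms])
qed

text \<open>Split \<open>u\<close> into \<open>E i u\<close> and \<open>L i u\<close> and apply the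
  perturbation bound to their partial squared norms \<open>A\<close>, \<open>T\<close> and inner
  product \<open>U\<close>. Averaging over \<open>i\<close> fixes \<open>A\<close>, which does not
  depend on \<open>i\<close>, and kills \<open>U\<close>, because \<open>E i\<close> annihilates
  \<open>L i u\<close>.\<close>

lemma one_coordinate_bound:
  assumes B: "finite B" "i \<notin> B" and m: "m \<ge> 1" and \<rho>: "\<rho> = 1 / (4 * sqrt (real m))"
  shows "E i (\<lambda>x. (ES B (\<lambda>y. (Top \<rho> i u y)\<^sup>2) x) ^ m) x
    \<le> (ES (insert i B) (\<lambda>y. (u y)\<^sup>2) x) ^ m
      + 3 * real m ^ m * E i (\<lambda>x. (ES B (\<lambda>y. (L i u y)\<^sup>2) x) ^ m) x"
proof -
  define a where "a = E i u"
  define h where "h = L i u"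
  define A where "A = ES B (\<lambda>y. (a y)\<^sup>2)"
  define U where "U = ES B (\<lambda>y. a y * h y)"
  define T where "T = ES B (\<lambda>y. (h y)\<^sup>2)"
  have ia: "indep i a" by (simp add: a_def indep_Eop)
  have iA: "indep i A" unfolding A_def by (intro indep_ES_other B indep_power2 ia)
  have A0: "0 \<le> A x" and T0: "0 \<le> T x" for x
    by (simp_all add: A_def T_def ES_nonneg B)
  have EU: "E i U = (\<lambda>x. 0)"
    using B by (simp add: U_def ES_Eop Eop_mult_indep ia) (simp add: h_def Eop_Lop_same)
  have split: "ES B (\<lambda>y. (a y + c * h y)\<^sup>2) x = A x + 2 * c * U x + c\<^sup>2 * T x" for c x
    by (simp add: A_def U_def T_def ES_square_sum B)
  have u: "u = (\<lambda>y. a y + h y)" by (simp add: a_def h_def Lop_def)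
  have "ES (insert i B) (\<lambda>y. (u y)\<^sup>2) = E i (\<lambda>x. (A x + 2 * U x) + T x)"
  proof -
    have "ES B (\<lambda>y. (u y)\<^sup>2) = (\<lambda>x. A x + 2 * U x + T x)"
      using split[of 1] by (auto simp: u)
    then show ?thesis by (simp only: ES_insert[OF B])
  qed
  also have "\<dots> = (\<lambda>x. A x + E i T x)"
    by (simp add: Eop_add Eop_scale EU Eop_indep[OF iA])
  finally have total: "ES (insert i B) (\<lambda>y. (u y)\<^sup>2) = (\<lambda>x. A x + E i T x)" .
  have "E i (\<lambda>x. (ES B (\<lambda>y. (Top \<rho> i u y)\<^sup>2) x) ^ m) x
      = E i (\<lambda>x. (A x + 2 * \<rho> * U x + \<rho>\<^sup>2 * T x) ^ m) x"
    by (simp add: Top_def split flip: a_def h_def)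
  also have "\<dots> \<le> E i (\<lambda>x. A x ^ m + (2 * real m * \<rho>) * (A x ^ (m - 1) * U x)
      + real m * (A x ^ (m - 1) * T x) + (3 * real m ^ m) * T x ^ m) x"
  proof (rule Eop_mono)
    fix x
    have "0 \<le> A x + 2 * \<rho> * U x + \<rho>\<^sup>2 * T x"
      unfolding split[symmetric] by (simp add: ES_nonneg B)
    moreover have "(U x)\<^sup>2 \<le> A x * T x"
      unfolding U_def A_def T_def by (rule ES_Cauchy_Schwarz[OF B(1)])
    ultimately show "(A x + 2 * \<rho> * U x + \<rho>\<^sup>2 * T x) ^ m
      \<le> A x ^ m + (2 * real m * \<rho>) * (A x ^ (m - 1) * U x)
      + real m * (A x ^ (m - 1) * T x) + (3 * real m ^ m) * T x ^ m"
      using power_perturbation_bound[OF m \<rho> A0[of x] T0[of x], of "U x"] by (simp add: mult_ac)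
  qed
  also have "\<dots> = A x ^ m + real m * A x ^ (m - 1) * E i T x + 3 * real m ^ m * E i (\<lambda>x. T x ^ m) x"
  proof -
    have iAk: "indep i (\<lambda>x. A x ^ k)" for k using iA by (simp add: indep_def)
    show ?thesis
      by (simp only: Eop_add Eop_scale Eop_mult_indep[OF iAk] Eop_indep[OF iAk] EU)
  qed
  \<comment> \<open>Bernoulli absorbs the first-order term; the result is the \<open>m\<close>-th
    power of the square averaged over \<open>i\<close> as well.\<close>
  also have "A x ^ m + real m * A x ^ (m - 1) * E i T x \<le> (A x + E i T x) ^ m"
  proof (rule power_add_ge_linear[OF A0])
    show "0 \<le> E i T x" using Eop_mono[of "\<lambda>_. 0" T i x] T0 by simp
  qed
  finally show ?thesis by (simp add: total T_def h_def)
qed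

text \<open>Induction on \<open>A\<close>, one coordinate at a time. Each new coordinate is either
  averaged inside the square, and so joins \<open>B\<close>, or differentiated at cost
  \<open>3 m^m\<close>, and so joins \<open>S\<close>; hence \<open>B\<close> and \<open>f\<close>
  vary in the induction.\<close>

lemma hypercontractive_moment_bound:
  assumes m: "m \<ge> 1" and \<rho>: "\<rho> = 1 / (4 * sqrt (real m))"
    and "A \<subseteq> {..<n}" "B \<subseteq> {..<n}" "A \<inter> B = {}"
  shows "expect mu n (\<lambda>x. (ES B (\<lambda>y. (TS \<rho> A f y)\<^sup>2) x) ^ m)
    \<le> (\<Sum>S\<in>Pow A. (3 * real m ^ m) ^ card S *
          expect mu n (\<lambda>x. (ES (B \<union> (A - S)) (\<lambda>y. (LS S f y)\<^sup>2) x) ^ m))"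
proof -
  define b where "b = 3 * real m ^ m"
  have b0: "0 \<le> b" by (simp add: b_def)
  have "finite A" using assms(3) finite_subset by blast
  then show ?thesis unfolding b_def[symmetric] using assms(3-5)
  proof (induction A arbitrary: f B rule: finite_induct)
    case (insert i A)
    have fB: "finite B" using insert.prems(2) finite_subset by blast
    have iB: "i \<notin> B" and i: "i < n" using insert.prems by auto
    define X where "X = (\<lambda>S. expect mu n (\<lambda>x. (ES (B \<union> (insert i A - S)) (\<lambda>y. (LS S f y)\<^sup>2) x) ^ m))"
    define u where "u = TS \<rho> A f"
    have "expect mu n (\<lambda>x. (ES B (\<lambda>y. (TS \<rho> (insert i A) f y)\<^sup>2) x) ^ m)
        = expect mu n (E i (\<lambda>x. (ES B (\<lambda>y. (Top \<rho> i u y)\<^sup>2) x) ^ m))"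
      using insert.hyps i by (simp add: TS_insert u_def expect_Eop)
    also have "\<dots> \<le> expect mu n (\<lambda>x. (ES (insert i B) (\<lambda>y. (u y)\<^sup>2) x) ^ m
      + b * E i (\<lambda>x. (ES B (\<lambda>y. (L i u y)\<^sup>2) x) ^ m) x)"
      unfolding b_def by (intro expect_mono one_coordinate_bound fB iB m \<rho>)
    also have "\<dots> = expect mu n (\<lambda>x. (ES (insert i B) (\<lambda>y. (u y)\<^sup>2) x) ^ m)
      + b * expect mu n (\<lambda>x. (ES B (\<lambda>y. (L i u y)\<^sup>2) x) ^ m)"
      using i by (simp add: expect_add expect_scale expect_Eop)
    \<comment> \<open>The summands with \<open>i\<close> outside \<open>S\<close>: the coordinate
      moves into the set of averaged ones.\<close>
    also have "expect mu n (\<lambda>x. (ES (insert i B) (\<lambda>y. (u y)\<^sup>2) x) ^ m)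
        \<le> (\<Sum>S\<in>Pow A. b ^ card S * X S)"
    proof -
      have "insert i B \<union> (A - S) = B \<union> (insert i A - S)" if "S \<in> Pow A" for S
        using that insert.hyps by auto
      then show ?thesis
        using insert.IH[of "insert i B" f] insert.prems insert.hyps by (simp add: u_def X_def)
    qed
    \<comment> \<open>The summands with \<open>i\<close> in \<open>S\<close>: \<open>L i\<close>
      commutes with the noise operator, so the induction hypothesis applies to
      \<open>L i f\<close>.\<close>
    also have "expect mu n (\<lambda>x. (ES B (\<lambda>y. (L i u y)\<^sup>2) x) ^ m)
        \<le> (\<Sum>S\<in>Pow A. b ^ card S * X (insert i S))"
    proof -
      have "B \<union> (A - S) = B \<union> (insert i A - insert i S) \<and> LS S (L i f) = LS (insert i S) f"
        if "S \<in> Pow A" for S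
      proof -
        have "finite S" "i \<notin> S" using that insert.hyps finite_subset by auto
        then show ?thesis using insert.hyps by (auto simp: LS_insert LS_Lop)
      qed
      then show ?thesis
        using insert.IH[of B "L i f"] insert.prems insert.hyps by (simp add: u_def X_def TS_Lop)
    qed
    also have "(\<Sum>S\<in>Pow A. b ^ card S * X S) + b * (\<Sum>S\<in>Pow A. b ^ card S * X (insert i S))
        = (\<Sum>S\<in>Pow (insert i A). b ^ card S * X S)"
    proof -
      have inj: "inj_on (insert i) (Pow A)" using insert.hyps by (auto simp: inj_on_def)
      have "(\<Sum>S\<in>insert i ` Pow A. b ^ card S * X S) = (\<Sum>S\<in>Pow A. b * (b ^ card S * X (insert i S)))"
        unfolding sum.reindex[OF inj]
      proof (rule sum.cong)
        fix S assume "S \<in> Pow A"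
        then have "finite S" "i \<notin> S" using insert.hyps finite_subset by auto
        then show "((\<lambda>S. b ^ card S * X S) \<circ> insert i) S = b * (b ^ card S * X (insert i S))"
          by (simp add: mult_ac)
      qed simp
      moreover have "Pow A \<inter> insert i ` Pow A = {}" using insert.hyps by auto
      ultimately show ?thesis
        using insert.hyps by (simp add: Pow_insert sum.union_disjoint sum_distrib_left)
    qed
    finally show ?case using b0 by (simp add: X_def mult_left_mono)
  qed simp
qed

section \<open>Level decomposition\<close>

lemma Lop_sum: "L i (\<lambda>x. \<Sum>T\<in>A. h T x) = (\<lambda>x. \<Sum>T\<in>A. L i (h T) x)"
  by (simp add: Lop_def Eop_sum sum_subtractf)

lemma Top_sum: "Top \<rho> i (\<lambda>x. \<Sum>T\<in>A. h T x) = (\<lambda>x. \<Sum>T\<in>A. Top \<rho> i (h T) x)"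
  by (simp add: Top_def Eop_sum Lop_sum sum.distrib sum_distrib_left)

lemma LS_sum: "finite S \<Longrightarrow> LS S (\<lambda>x. \<Sum>T\<in>A. h T x) = (\<lambda>x. \<Sum>T\<in>A. LS S (h T) x)"
  by (induction S rule: finite_induct) (simp_all add: LS_insert Lop_sum)

lemma TS_sum: "finite S \<Longrightarrow> TS \<rho> S (\<lambda>x. \<Sum>T\<in>A. h T x) = (\<lambda>x. \<Sum>T\<in>A. TS \<rho> S (h T) x)"
  by (induction S rule: finite_induct) (simp_all add: TS_insert Top_sum)

section \<open>The parts as joint eigenfunctions of the operators\<close>

abbreviation "part \<equiv> fpart mu"

lemma fpart_eq: "part n T f = ES ({..<n} - T) (LS T f)"
  by (simp add: fpart_def ESop_eq LSop_eq)

lemma Eop_fpart_outside: "i < n \<Longrightarrow> i \<notin> T \<Longrightarrow> E i (part n T f) = part n T f"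
  by (simp add: fpart_eq Eop_indep indep_ES)

lemma Eop_fpart_inside:
  assumes "finite T" "i \<in> T"
  shows "E i (part n T f) = (\<lambda>x. 0)"
proof -
  have "LS T f = L i (LS (T - {i}) f)"
    using LS_insert[of "T - {i}" i f] assms by (simp add: insert_absorb)
  then show ?thesis by (simp add: fpart_eq ES_Eop Eop_Lop_same)
qed

text \<open>Averaging a coordinate inside \<open>T\<close> kills the part and averaging one outside
  fixes it, so \<open>L i\<close> fixes the part in the first case and kills it in the
  second.\<close>

lemma LS_fpart:
  assumes "finite T" "S \<subseteq> {..<n}"
  shows "LS S (part n T f) = (if S \<subseteq> T then part n T f else (\<lambda>x. 0))"
proof -
  have "finite S" using assms(2) finite_subset by blast
  then show ?thesis using assms(2)
    by (induction S rule: finite_induct)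
      (auto simp: LS_insert Lop_def Eop_fpart_inside assms(1) Eop_fpart_outside)
qed

lemma TS_fpart:
  assumes "finite T" "S \<subseteq> {..<n}"
  shows "TS \<rho> S (part n T f) = (\<lambda>x. \<rho> ^ card (S \<inter> T) * part n T f x)"
proof -
  have "finite S" using assms(2) finite_subset by blast
  then show ?thesis using assms(2)
  proof (induction S rule: finite_induct)
    case (insert i S)
    have "Top \<rho> i (\<lambda>x. c * g x) = (\<lambda>x. c * Top \<rho> i g x)" for c g
      by (simp add: Top_def Eop_scale Lop_scale algebra_simps)
    moreover have "Top \<rho> i (part n T f) = (\<lambda>x. (if i \<in> T then \<rho> else 1) * part n T f x)"
      using insert.prems by (simp add: Top_def Lop_def Eop_fpart_inside assms(1) Eop_fpart_outside)
    ultimately show ?case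
      using insert by (auto simp: TS_insert)
  qed simp
qed

section \<open>Self-adjointness and orthogonality of the parts\<close>

lemma expect_Eop_adjoint:
  assumes "i < n"
  shows "expect mu n (\<lambda>x. E i u x * h x) = expect mu n (\<lambda>x. u x * E i h x)"
proof -
  have "expect mu n (\<lambda>x. E i u x * h x) = expect mu n (E i (\<lambda>x. E i u x * h x))"
    by (simp add: expect_Eop assms)
  also have "\<dots> = expect mu n (\<lambda>x. E i u x * E i h x)"
    by (simp add: Eop_mult_indep indep_Eop)
  also have "\<dots> = expect mu n (E i (\<lambda>x. E i h x * u x))"
    by (subst Eop_mult_indep[OF indep_Eop]) (simp add: mult.commute)
  also have "\<dots> = expect mu n (\<lambda>x. u x * E i h x)"
    by (simp add: expect_Eop assms mult.commute)
  finally show ?thesis .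
qed

lemma expect_ES_mult:
  assumes "B \<subseteq> {..<n}" "\<And>i. i \<in> B \<Longrightarrow> E i h = h"
  shows "expect mu n (\<lambda>x. ES B u x * h x) = expect mu n (\<lambda>x. u x * h x)"
proof -
  have "finite B" using assms(1) finite_subset by blast
  then show ?thesis using assms
    by (induction B rule: finite_induct) (simp_all add: ES_insert expect_Eop_adjoint)
qed

lemma expect_LS_mult:
  assumes "B \<subseteq> {..<n}" "\<And>i. i \<in> B \<Longrightarrow> E i h = (\<lambda>x. 0)"
  shows "expect mu n (\<lambda>x. LS B u x * h x) = expect mu n (\<lambda>x. u x * h x)"
proof -
  have "finite B" using assms(1) finite_subset by blast
  then show ?thesis using assms
  proof (induction B rule: finite_induct)
    case (insert i B)
    define v where "v = LS B u"
    have "expect mu n (\<lambda>x. L i v x * h x)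
        = expect mu n (\<lambda>x. v x * h x + (- 1) * (E i v x * h x))"
      by (simp add: Lop_def algebra_simps)
    also have "\<dots> = expect mu n (\<lambda>x. v x * h x)"
      using insert.prems unfolding expect_add expect_scale by (simp add: expect_Eop_adjoint)
    finally show ?case using insert by (simp add: LS_insert v_def)
  qed simp
qed

text \<open>Taking a part acts as an orthogonal projection: in one factor the averages outside
  \<open>T\<close> and the Laplacians inside \<open>T\<close> are moved across to the other factor,
  which they fix.\<close>

lemma expect_fpart_square:
  assumes "T \<subseteq> {..<n}"
  shows "expect mu n (\<lambda>x. (part n T f x)\<^sup>2) = expect mu n (\<lambda>x. f x * part n T f x)"
proof -
  have T: "finite T" using assms finite_subset by blast
  define h where "h = part n T f"
  have "expect mu n (\<lambda>x. (h x)\<^sup>2) = expect mu n (\<lambda>x. ES ({..<n} - T) (LS T f) x * h x)"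
    by (simp add: h_def power2_eq_square flip: fpart_eq)
  also have "\<dots> = expect mu n (\<lambda>x. LS T f x * h x)"
    by (rule expect_ES_mult) (auto simp: h_def Eop_fpart_outside)
  also have "\<dots> = expect mu n (\<lambda>x. f x * h x)"
    by (rule expect_LS_mult[OF assms]) (simp add: h_def Eop_fpart_inside T)
  finally show ?thesis by (simp add: h_def)
qed

text \<open>Take \<open>i\<close> in exactly one of the two sets. Averaging over \<open>i\<close>
  fixes one part, and moved across by self-adjointness it kills the other.\<close>

lemma fpart_orthogonal:
  assumes "T \<subseteq> {..<n}" "T' \<subseteq> {..<n}" "T \<noteq> T'"
  shows "expect mu n (\<lambda>x. part n T f x * part n T' g x) = 0"
proof -
  have *: "expect mu n (\<lambda>x. part n T f x * part n T' g x) = 0"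
    if "T \<subseteq> {..<n}" "i \<in> T" "i \<notin> T'" for T T' i f g
  proof -
    have i: "i < n" and T: "finite T" using that finite_subset by auto
    have "expect mu n (\<lambda>x. part n T f x * part n T' g x)
        = expect mu n (\<lambda>x. part n T f x * E i (part n T' g) x)"
      by (simp add: Eop_fpart_outside i that)
    also have "\<dots> = expect mu n (\<lambda>x. E i (part n T f) x * part n T' g x)"
      by (simp add: expect_Eop_adjoint i)
    also have "\<dots> = 0" by (simp add: Eop_fpart_inside T that)
    finally show ?thesis .
  qed
  from assms(3) obtain i where "i \<in> T \<and> i \<notin> T' \<or> i \<in> T' \<and> i \<notin> T" by blast
  then show ?thesis
    using *[of T i T' f g] *[of T' i T g f] assms by (auto simp: mult.commute)
qed

lemma expect_square_sum_fpart:
  assumes "finite \<T>" "\<And>T. T \<in> \<T> \<Longrightarrow> T \<subseteq> {..<n}"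
  shows "expect mu n (\<lambda>x. (\<Sum>T\<in>\<T>. part n T f x)\<^sup>2) = (\<Sum>T\<in>\<T>. expect mu n (\<lambda>x. (part n T f x)\<^sup>2))"
proof -
  have "expect mu n (\<lambda>x. (\<Sum>T\<in>\<T>. part n T f x)\<^sup>2)
      = (\<Sum>T\<in>\<T>. \<Sum>T'\<in>\<T>. expect mu n (\<lambda>x. part n T f x * part n T' f x))"
    by (simp add: power2_eq_square sum_product expect_sum)
  also have "\<dots> = (\<Sum>T\<in>\<T>. \<Sum>T'\<in>\<T>. if T' = T then expect mu n (\<lambda>x. (part n T f x)\<^sup>2) else 0)"
    by (intro sum.cong refl) (auto simp: power2_eq_square fpart_orthogonal assms(2))
  also have "\<dots> = (\<Sum>T\<in>\<T>. expect mu n (\<lambda>x. (part n T f x)\<^sup>2))"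
    using assms(1) by simp
  finally show ?thesis .
qed

section \<open>Identities for a whole level\<close>

lemma finite_level: "finite {T. T \<subseteq> {..<n} \<and> card T = j}"
  for n :: nat
  by (rule finite_subset[of _ "Pow {..<n}"]) auto

lemma LS_flevel:
  assumes "S \<subseteq> {..<n}"
  shows "LS S (flevel mu n j f) = (\<lambda>x. \<Sum>T\<in>{T. T \<subseteq> {..<n} \<and> card T = j \<and> S \<subseteq> T}. part n T f x)"
proof -
  have S: "finite S" using assms finite_subset by blast
  have "LS S (flevel mu n j f)
      = (\<lambda>x. \<Sum>T\<in>{T. T \<subseteq> {..<n} \<and> card T = j}. if S \<subseteq> T then part n T f x else 0)"
    unfolding flevel_def LS_sum[OF S]
  proof (intro ext sum.cong refl)
    fix x T assume "T \<in> {T. T \<subseteq> {..<n} \<and> card T = j}"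
    then have "finite T" using finite_subset by auto
    then show "LS S (part n T f) x = (if S \<subseteq> T then part n T f x else 0)"
      by (simp add: LS_fpart[OF _ assms])
  qed
  also have "\<dots> = (\<lambda>x. \<Sum>T\<in>{T. T \<subseteq> {..<n} \<and> card T = j \<and> S \<subseteq> T}. part n T f x)"
  proof
    fix x
    have *: "{T. T \<subseteq> {..<n} \<and> card T = j} \<inter> {T. S \<subseteq> T} = {T. T \<subseteq> {..<n} \<and> card T = j \<and> S \<subseteq> T}"
      by auto
    show "(\<Sum>T\<in>{T. T \<subseteq> {..<n} \<and> card T = j}. if S \<subseteq> T then part n T f x else 0)
        = (\<Sum>T\<in>{T. T \<subseteq> {..<n} \<and> card T = j \<and> S \<subseteq> T}. part n T f x)"
      by (simp add: sum.If_cases[OF finite_level] *)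
  qed
  finally show ?thesis .
qed

lemma TS_flevel: "TS \<rho> {..<n} (flevel mu n j f) = (\<lambda>x. \<rho> ^ j * flevel mu n j f x)"
proof -
  have "TS \<rho> {..<n} (flevel mu n j f)
      = (\<lambda>x. \<Sum>T\<in>{T. T \<subseteq> {..<n} \<and> card T = j}. \<rho> ^ card ({..<n} \<inter> T) * part n T f x)"
    unfolding flevel_def TS_sum[OF finite_lessThan]
    by (intro ext sum.cong refl) (auto simp: TS_fpart finite_subset)
  also have "\<dots> = (\<lambda>x. \<rho> ^ j * flevel mu n j f x)"
    unfolding flevel_def sum_distrib_left
    by (intro ext sum.cong refl) (auto simp: Int_absorb1)
  finally show ?thesis .
qed

lemma expect_mult_flevel:
  "expect mu n (\<lambda>x. f x * flevel mu n j f x) = expect mu n (\<lambda>x. (flevel mu n j f x)\<^sup>2)"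
proof -
  have "expect mu n (\<lambda>x. f x * flevel mu n j f x)
      = (\<Sum>T\<in>{T. T \<subseteq> {..<n} \<and> card T = j}. expect mu n (\<lambda>x. (part n T f x)\<^sup>2))"
    unfolding flevel_def sum_distrib_left expect_sum
    by (intro sum.cong refl) (auto simp: expect_fpart_square)
  also have "\<dots> = expect mu n (\<lambda>x. (flevel mu n j f x)\<^sup>2)"
    unfolding flevel_def by (intro expect_square_sum_fpart[symmetric] finite_level) auto
  finally show ?thesis .
qed

text \<open>By orthogonality, \<open>LS S\<close> retains the energy of the parts indexed by
  supersets of \<open>S\<close>. Exchanging the sums counts each \<open>T\<close> once for each of
  its \<open>2^j\<close> subsets.\<close>

lemma sum_expect_LS_flevel:
  "(\<Sum>S\<in>Pow {..<n}. expect mu n (\<lambda>x. (LS S (flevel mu n j f) x)\<^sup>2))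
    = 2 ^ j * expect mu n (\<lambda>x. (flevel mu n j f x)\<^sup>2)"
proof -
  define e where "e T = expect mu n (\<lambda>x. (part n T f x)\<^sup>2)" for T
  define \<L> where "\<L> = {T. T \<subseteq> {..<n} \<and> card T = j}"
  have fin: "finite \<L>" by (simp add: \<L>_def finite_level)
  have "expect mu n (\<lambda>x. (LS S (flevel mu n j f) x)\<^sup>2) = (\<Sum>T\<in>{T \<in> \<L>. S \<subseteq> T}. e T)"
    if "S \<in> Pow {..<n}" for S
  proof -
    have *: "{T. T \<subseteq> {..<n} \<and> card T = j \<and> S \<subseteq> T} = {T \<in> \<L>. S \<subseteq> T}" by (auto simp: \<L>_def)
    have "expect mu n (\<lambda>x. (\<Sum>T\<in>{T \<in> \<L>. S \<subseteq> T}. part n T f x)\<^sup>2) = (\<Sum>T\<in>{T \<in> \<L>. S \<subseteq> T}. e T)"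
      unfolding e_def by (rule expect_square_sum_fpart) (auto simp: fin, auto simp: \<L>_def)
    then show ?thesis using that by (simp only: LS_flevel Pow_iff *)
  qed
  then have "(\<Sum>S\<in>Pow {..<n}. expect mu n (\<lambda>x. (LS S (flevel mu n j f) x)\<^sup>2))
      = (\<Sum>S\<in>Pow {..<n}. \<Sum>T\<in>{T \<in> \<L>. S \<subseteq> T}. e T)"
    by simp
  also have "\<dots> = (\<Sum>T\<in>\<L>. \<Sum>S\<in>{S \<in> Pow {..<n}. S \<subseteq> T}. e T)"
    by (rule sum.swap_restrict) (simp_all add: fin)
  also have "\<dots> = (\<Sum>T\<in>\<L>. 2 ^ j * e T)"
  proof (rule sum.cong[OF refl])
    fix T assume T: "T \<in> \<L>"
    then have "{S \<in> Pow {..<n}. S \<subseteq> T} = Pow T" by (auto simp: \<L>_def)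
    moreover have "finite T" "card T = j" using T finite_subset by (auto simp: \<L>_def)
    ultimately show "(\<Sum>S\<in>{S \<in> Pow {..<n}. S \<subseteq> T}. e T) = 2 ^ j * e T"
      by (simp add: card_Pow)
  qed
  also have "\<dots> = 2 ^ j * (\<Sum>T\<in>\<L>. e T)" by (simp add: sum_distrib_left)
  also have "(\<Sum>T\<in>\<L>. e T) = expect mu n (\<lambda>x. (flevel mu n j f x)\<^sup>2)"
    unfolding e_def \<L>_def flevel_def
    by (intro expect_square_sum_fpart[symmetric] finite_level) auto
  finally show ?thesis .
qed

lemma fpart_derivative_disjoint:
  assumes "S \<subseteq> {..<n}" "T \<subseteq> {..<n}" "T \<inter> S = {}"
  shows "part n T (restr (LS S f) S x) = restr (part n (T \<union> S) f) S x"
proof -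
  have fin: "finite S" "finite T" using assms finite_subset by blast+
  have "LS T (restr (LS S f) S x) = restr (LS (T \<union> S) f) S x"
    using fin assms(3) by (simp add: LS_restr LS_Un)
  moreover have "{..<n} - T = ({..<n} - (T \<union> S)) \<union> S" using assms by auto
  moreover have "({..<n} - (T \<union> S)) \<inter> S = {}" by auto
  ultimately show ?thesis
    using fin by (simp add: fpart_eq ES_Un ES_indep indep_restr ES_restr)
qed

text \<open>After restriction the function no longer depends on \<open>i\<close>, so the Laplacian
  at \<open>i\<close> annihilates it.\<close>

lemma fpart_derivative_meet:
  assumes "finite T" "i \<in> T" "i \<in> S"
  shows "part n T (restr f S x) = (\<lambda>y. 0)"
proof -
  have "LS T (restr f S x) = LS (T - {i}) (L i (restr f S x))"
    using LS_insert[of "T - {i}" i "restr f S x"] assms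
    by (simp add: insert_absorb LS_Lop)
  then show ?thesis using assms by (simp add: fpart_eq Lop_indep indep_restr)
qed

text \<open>Makes induction on the level possible: a derivative of a level part is a lower level
  part of a derivative of \<open>f\<close>. Sets meeting \<open>S\<close> contribute zero, and
  adding \<open>S\<close> to the remaining ones is a bijection onto the \<open>j\<close>-sets
  containing \<open>S\<close>.\<close>

lemma derivative_flevel:
  assumes "S \<subseteq> {..<n}" "card S \<le> j"
  shows "restr (LS S (flevel mu n j f)) S x = flevel mu n (j - card S) (restr (LS S f) S x)"
proof
  fix y
  have fin: "finite S" using assms finite_subset by blast
  define \<A> where "\<A> = {T. T \<subseteq> {..<n} \<and> card T = j - card S}"
  have "flevel mu n (j - card S) (restr (LS S f) S x) y
      = (\<Sum>T\<in>\<A>. if T \<inter> S = {} then restr (part n (T \<union> S) f) S x y else 0)"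
    unfolding flevel_def \<A>_def[symmetric]
  proof (rule sum.cong[OF refl])
    fix T assume "T \<in> \<A>"
    then have T: "T \<subseteq> {..<n}" "finite T" using finite_subset by (auto simp: \<A>_def)
    show "part n T (restr (LS S f) S x) y
      = (if T \<inter> S = {} then restr (part n (T \<union> S) f) S x y else 0)"
    proof (cases "T \<inter> S = {}")
      case False
      then obtain i where "i \<in> T" "i \<in> S" by blast
      then show ?thesis using fpart_derivative_meet[OF T(2)] False by simp
    qed (use fpart_derivative_disjoint[OF assms(1) T(1)] in simp)
  qed
  also have "\<dots> = (\<Sum>T\<in>\<A> \<inter> {T. T \<inter> S = {}}. restr (part n (T \<union> S) f) S x y)"
    by (simp add: sum.If_cases \<A>_def finite_level)
  also have "\<dots> = (\<Sum>T\<in>{T. T \<subseteq> {..<n} \<and> card T = j \<and> S \<subseteq> T}. restr (part n T f) S x y)"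
  proof (rule sum.reindex_bij_witness[of _ "\<lambda>T. T - S" "\<lambda>T. T \<union> S"])
    fix T assume T: "T \<in> \<A> \<inter> {T. T \<inter> S = {}}"
    then have "finite T" using finite_subset by (auto simp: \<A>_def)
    then show "T \<union> S \<in> {T. T \<subseteq> {..<n} \<and> card T = j \<and> S \<subseteq> T}"
      using T assms fin by (auto simp: \<A>_def card_Un_disjoint)
  next
    fix T assume T: "T \<in> {T. T \<subseteq> {..<n} \<and> card T = j \<and> S \<subseteq> T}"
    then show "T - S \<in> \<A> \<inter> {T. T \<inter> S = {}}"
      using fin by (auto simp: \<A>_def card_Diff_subset)
  qed auto
  also have "\<dots> = restr (LS S (flevel mu n j f)) S x y"
    by (simp add: LS_flevel assms restr_def)
  finally show "restr (LS S (flevel mu n j f)) S x y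
      = flevel mu n (j - card S) (restr (LS S f) S x) y" by simp
qed

section \<open>Derivatives of global functions\<close>

text \<open>The hypothesis of the theorem, with the second norm squared to avoid roots and with the
  level and both bounds as parameters, since derivatives change all three.\<close>

definition global :: "nat \<Rightarrow> nat \<Rightarrow> real \<Rightarrow> real \<Rightarrow> real \<Rightarrow> ((nat \<Rightarrow> 'a) \<Rightarrow> real) \<Rightarrow> bool" where
  "global n j r \<gamma>1 \<gamma>2 f \<longleftrightarrow> (\<forall>S x. S \<subseteq> {..<n} \<longrightarrow> card S \<le> j \<longrightarrow>
     expect mu n (\<lambda>y. \<bar>restr f S x y\<bar>) \<le> r ^ card S * \<gamma>1 \<and>
     expect mu n (\<lambda>y. (restr f S x y)\<^sup>2) \<le> (r ^ card S * \<gamma>2)\<^sup>2)"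

lemma Jensen_square: "(\<Sum>w\<in>UNIV. mu w * b w)\<^sup>2 \<le> (\<Sum>w\<in>UNIV. mu w * (b w)\<^sup>2)"
proof -
  define M where "M = (\<Sum>w\<in>UNIV. mu w * b w)"
  have "0 \<le> (\<Sum>w\<in>UNIV. mu w * (b w - M)\<^sup>2)" by (simp add: sum_nonneg)
  also have "\<dots> = (\<Sum>w\<in>UNIV. mu w * (b w)\<^sup>2 - 2 * M * (mu w * b w) + M\<^sup>2 * mu w)"
    by (simp add: power2_eq_square algebra_simps)
  also have "\<dots> = (\<Sum>w\<in>UNIV. mu w * (b w)\<^sup>2) - 2 * M * M + M\<^sup>2"
    by (simp add: sum.distrib sum_subtractf M_def flip: sum_distrib_left)
  finally show ?thesis by (simp add: M_def power2_eq_square)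
qed

text \<open>The derivative is one restriction of \<open>f\<close> at coordinate \<open>i\<close>
  minus an average of such restrictions. Each fixes at most one more coordinate, which costs a
  factor \<open>r\<close>, and the difference costs a factor 2. If \<open>i\<close> already lies in
  \<open>U\<close> no coordinate is added, and \<open>1 \<le> r\<close> covers this case.\<close>

lemma global_derivative_one:
  assumes glob: "global n (Suc j) r \<gamma>1 \<gamma>2 f" and i: "i < n" and r: "1 \<le> r"
    and \<gamma>: "0 \<le> \<gamma>1" "0 \<le> \<gamma>2"
  shows "global n j r (2 * r * \<gamma>1) (2 * r * \<gamma>2) (restr (L i f) {i} x)"
  unfolding global_def
proof (intro allI impI)
  fix U z assume U: "U \<subseteq> {..<n}" "card U \<le> j"
  have fU: "finite U" using U(1) finite_subset by blast
  define h where "h c = restr f (insert i U) (z(i := c))" for c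
  have eq: "restr (restr (L i f) {i} x) U z y = h (x i) y - (\<Sum>w\<in>UNIV. mu w * h w y)" for y
  proof -
    have "(\<lambda>k. if k \<in> insert i U then (z(i := c)) k else y k)
        = (\<lambda>k. if k \<in> U then z k else y k)(i := c)" for c by auto
    moreover have "(\<lambda>k. if k \<in> {i} then x k else v k) = v(i := x i)" for v by auto
    ultimately show ?thesis by (simp only: h_def restr_def Lop_def Eop_def fun_upd_upd)
  qed
  have "insert i U \<subseteq> {..<n}" "card (insert i U) \<le> Suc j"
    using U i card_insert_le_m1[of "Suc j" U i] by auto
  then have h: "expect mu n (\<lambda>y. \<bar>h c y\<bar>) \<le> r ^ card (insert i U) * \<gamma>1"
    "expect mu n (\<lambda>y. (h c y)\<^sup>2) \<le> (r ^ card (insert i U) * \<gamma>2)\<^sup>2" for c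
    using glob by (auto simp: global_def h_def)
  have pow: "r ^ card (insert i U) \<le> r ^ Suc (card U)"
    using r fU by (intro power_increasing) (auto simp: card_insert_if)
  have h1: "expect mu n (\<lambda>y. \<bar>h c y\<bar>) \<le> r ^ Suc (card U) * \<gamma>1" for c
    using h(1) pow \<gamma> by (meson mult_right_mono order_trans)
  have h2: "expect mu n (\<lambda>y. (h c y)\<^sup>2) \<le> (r ^ Suc (card U) * \<gamma>2)\<^sup>2" for c
  proof -
    have "(r ^ card (insert i U) * \<gamma>2)\<^sup>2 \<le> (r ^ Suc (card U) * \<gamma>2)\<^sup>2"
      using pow \<gamma> r by (intro power_mono mult_right_mono) auto
    then show ?thesis using h(2)[of c] by linarith
  qed
  have avg: "(\<Sum>w\<in>UNIV. mu w * b w) \<le> c" if "\<And>w. b w \<le> c" for b and c :: real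
  proof -
    have "(\<Sum>w\<in>UNIV. mu w * b w) \<le> (\<Sum>w\<in>UNIV. mu w * c)"
      by (intro sum_mono mult_left_mono that) simp
    then show ?thesis by (simp flip: sum_distrib_right)
  qed
  show "expect mu n (\<lambda>y. \<bar>restr (restr (L i f) {i} x) U z y\<bar>) \<le> r ^ card U * (2 * r * \<gamma>1) \<and>
    expect mu n (\<lambda>y. (restr (restr (L i f) {i} x) U z y)\<^sup>2) \<le> (r ^ card U * (2 * r * \<gamma>2))\<^sup>2"
  proof
    have "expect mu n (\<lambda>y. \<bar>restr (restr (L i f) {i} x) U z y\<bar>)
        \<le> expect mu n (\<lambda>y. \<bar>h (x i) y\<bar> + (\<Sum>w\<in>UNIV. mu w * \<bar>h w y\<bar>))"
    proof (rule expect_mono)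
      fix y
      have "\<bar>\<Sum>w\<in>UNIV. mu w * h w y\<bar> \<le> (\<Sum>w\<in>UNIV. mu w * \<bar>h w y\<bar>)"
        using sum_abs[of "\<lambda>w. mu w * h w y" UNIV] by (simp add: abs_mult)
      then show "\<bar>restr (restr (L i f) {i} x) U z y\<bar> \<le> \<bar>h (x i) y\<bar> + (\<Sum>w\<in>UNIV. mu w * \<bar>h w y\<bar>)"
        unfolding eq by linarith
    qed
    also have "\<dots> = expect mu n (\<lambda>y. \<bar>h (x i) y\<bar>) + (\<Sum>w\<in>UNIV. mu w * expect mu n (\<lambda>y. \<bar>h w y\<bar>))"
      by (simp add: expect_add expect_sum expect_scale)
    also have "\<dots> \<le> r ^ Suc (card U) * \<gamma>1 + r ^ Suc (card U) * \<gamma>1"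
      by (intro add_mono avg h1)
    finally show "expect mu n (\<lambda>y. \<bar>restr (restr (L i f) {i} x) U z y\<bar>) \<le> r ^ card U * (2 * r * \<gamma>1)"
      by (simp add: mult_ac)
  next
    have "expect mu n (\<lambda>y. (restr (restr (L i f) {i} x) U z y)\<^sup>2)
        \<le> expect mu n (\<lambda>y. 2 * (h (x i) y)\<^sup>2 + 2 * (\<Sum>w\<in>UNIV. mu w * (h w y)\<^sup>2))"
    proof (rule expect_mono)
      fix y
      define s where "s = (\<Sum>w\<in>UNIV. mu w * h w y)"
      have "0 \<le> (h (x i) y + s)\<^sup>2" by simp
      then have "(h (x i) y - s)\<^sup>2 \<le> 2 * (h (x i) y)\<^sup>2 + 2 * s\<^sup>2"
        by (simp add: power2_eq_square algebra_simps)
      also have "s\<^sup>2 \<le> (\<Sum>w\<in>UNIV. mu w * (h w y)\<^sup>2)" unfolding s_def by (rule Jensen_square)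
      finally show "(restr (restr (L i f) {i} x) U z y)\<^sup>2
          \<le> 2 * (h (x i) y)\<^sup>2 + 2 * (\<Sum>w\<in>UNIV. mu w * (h w y)\<^sup>2)"
        by (simp add: eq s_def)
    qed
    also have "\<dots> = 2 * expect mu n (\<lambda>y. (h (x i) y)\<^sup>2)
        + 2 * (\<Sum>w\<in>UNIV. mu w * expect mu n (\<lambda>y. (h w y)\<^sup>2))"
      by (simp add: expect_add expect_sum expect_scale)
    also have "\<dots> \<le> 2 * (r ^ Suc (card U) * \<gamma>2)\<^sup>2 + 2 * (r ^ Suc (card U) * \<gamma>2)\<^sup>2"
      by (intro add_mono mult_left_mono avg h2) auto
    also have "\<dots> = (r ^ card U * (2 * r * \<gamma>2))\<^sup>2"
      by (simp add: power_mult_distrib mult_ac)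
    finally show "expect mu n (\<lambda>y. (restr (restr (L i f) {i} x) U z y)\<^sup>2)
        \<le> (r ^ card U * (2 * r * \<gamma>2))\<^sup>2" .
  qed
qed

lemma derivative_insert:
  assumes "finite S" "i \<notin> S"
  shows "restr (LS (insert i S) f) (insert i S) x = restr (L i (restr (LS S f) S x)) {i} x"
proof -
  have "restr (restr k S x) {i} x = restr k (insert i S) x" for k :: "(nat \<Rightarrow> 'a) \<Rightarrow> real"
    by (auto simp: restr_def fun_eq_iff intro!: arg_cong[of _ _ k])
  then show ?thesis using assms by (simp add: LS_insert Lop_restr)
qed

lemma global_derivative:
  assumes "global n j r \<gamma>1 \<gamma>2 f" "S \<subseteq> {..<n}" "card S \<le> j" "1 \<le> r" "0 \<le> \<gamma>1" "0 \<le> \<gamma>2"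
  shows "global n (j - card S) r ((2 * r) ^ card S * \<gamma>1) ((2 * r) ^ card S * \<gamma>2) (restr (LS S f) S x)"
proof -
  have "finite S" using assms(2) finite_subset by blast
  then show ?thesis using assms(2,3)
  proof (induction S rule: finite_induct)
    case empty
    then show ?case using assms by simp
  next
    case (insert i S)
    have "global n (Suc (j - card (insert i S))) r ((2 * r) ^ card S * \<gamma>1) ((2 * r) ^ card S * \<gamma>2)
        (restr (LS S f) S x)"
      using insert by (simp add: Suc_diff_Suc Suc_le_eq)
    from global_derivative_one[OF this, of i x] show ?case
      using insert assms by (simp add: derivative_insert mult_ac)
  qed
qed

section \<open>The level inequality\<close>

text \<open>The noise operator multiplies the level part by \<open>\<rho>^j\<close>, so the
  hypercontractive bound controls its own \<open>2m\<close>-th moment. The hypothesis on derivatives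
  reduces the \<open>m\<close>-th powers on the right to first powers, whose sum is known
  exactly.\<close>

lemma moment_flevel_bound:
  assumes m: "m \<ge> 2" and r: "1 \<le> r" and N: "0 \<le> N"
    and P: "P\<^sup>2 = 32 * real m * r\<^sup>2"
    and N2: "expect mu n (\<lambda>x. (flevel mu n j f x)\<^sup>2) = N\<^sup>2"
    and deriv: "\<And>S x. S \<subseteq> {..<n} \<Longrightarrow>
      expect mu n (\<lambda>y. (restr (LS S (flevel mu n j f)) S x y)\<^sup>2) \<le> N\<^sup>2 * (1 / (8 * real m)) ^ card S"
  shows "expect mu n (\<lambda>x. (flevel mu n j f x) ^ (2 * m)) \<le> ((N * P ^ j) ^ m)\<^sup>2"
proof -
  define g where "g = flevel mu n j f"
  define \<rho> where "\<rho> = 1 / (4 * sqrt (real m))"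
  define b where "b = 3 * real m ^ m"
  have m0: "real m > 0" using m by simp
  have \<rho>2: "\<rho>\<^sup>2 = 1 / (16 * real m)"
    using m0 by (simp add: \<rho>_def power_divide power_mult_distrib)
  \<comment> \<open>Each element of \<open>S\<close> costs \<open>b\<close> and gains
    \<open>8 m\<close> in \<open>m - 1\<close> of the \<open>m\<close> factors, so its net
    contribution is at most one.\<close>
  have small: "b * (1 / (8 * real m)) ^ (m - 1) \<le> 1"
  proof -
    have "b * (1 / (8 * real m)) ^ (m - 1) = 3 * real m * (real m * (1 / (8 * real m))) ^ (m - 1)"
      unfolding power_mult_distrib using m by (simp add: b_def power_eq_if)
    also have "\<dots> = 3 * real m / 8 ^ (m - 1)"
      using m0 by (simp add: power_divide)
    also have "\<dots> \<le> 1" using three_times_le_power_8[OF m] by simp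
    finally show ?thesis .
  qed
  have "expect mu n (\<lambda>x. (\<rho> ^ (2 * j)) ^ m * (g x) ^ (2 * m))
      = expect mu n (\<lambda>x. (ES {} (\<lambda>y. (TS \<rho> {..<n} g y)\<^sup>2) x) ^ m)"
    by (simp add: g_def TS_flevel power_mult_distrib power_mult mult_ac flip: power_mult)
  also have "\<dots> \<le> (\<Sum>S\<in>Pow {..<n}. b ^ card S *
      expect mu n (\<lambda>x. (ES ({} \<union> ({..<n} - S)) (\<lambda>y. (LS S g y)\<^sup>2) x) ^ m))"
    unfolding b_def using m by (intro hypercontractive_moment_bound) (auto simp: \<rho>_def)
  also have "\<dots> \<le> (\<Sum>S\<in>Pow {..<n}. (N\<^sup>2) ^ (m - 1) * expect mu n (\<lambda>x. (LS S g x)\<^sup>2))"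
  proof (rule sum_mono)
    fix S assume "S \<in> Pow {..<n}"
    then have S: "S \<subseteq> {..<n}" by simp
    define s where "s = card S"
    define q where "q = N\<^sup>2 * (1 / (8 * real m)) ^ s"
    define V where "V = ES ({..<n} - S) (\<lambda>y. (LS S g y)\<^sup>2)"
    have V0: "0 \<le> V x" for x by (simp add: V_def ES_nonneg)
    \<comment> \<open>All but one of the \<open>m\<close> factors \<open>V x\<close> are replaced by
      the uniform bound \<open>q\<close>; the last one keeps the energy of
      \<open>LS S g\<close>.\<close>
    have "expect mu n (\<lambda>x. V x ^ m) \<le> expect mu n (\<lambda>x. q ^ (m - 1) * V x)"
    proof (rule expect_mono_PiE)
      fix x :: "nat \<Rightarrow> 'a" assume x: "x \<in> PiE {..<n} (\<lambda>_. UNIV)"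
      have "V x = expect mu n (restr (\<lambda>y. (LS S g y)\<^sup>2) S x)"
        by (simp add: V_def expect_restr[OF S x])
      also have "\<dots> = expect mu n (\<lambda>y. (restr (LS S g) S x y)\<^sup>2)"
        by (simp add: restr_def)
      also have "\<dots> \<le> q" using deriv[OF S] by (simp add: g_def q_def s_def)
      finally have "V x ^ (m - 1) * V x \<le> q ^ (m - 1) * V x"
        using V0 by (intro mult_right_mono power_mono) auto
      then show "V x ^ m \<le> q ^ (m - 1) * V x"
        using m by (cases m) (auto simp: mult.commute)
    qed
    also have "\<dots> = q ^ (m - 1) * expect mu n (\<lambda>x. (LS S g x)\<^sup>2)"
      by (simp add: expect_scale V_def expect_ES)
    finally have "b ^ s * expect mu n (\<lambda>x. V x ^ m)
        \<le> b ^ s * (q ^ (m - 1) * expect mu n (\<lambda>x. (LS S g x)\<^sup>2))"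
      by (intro mult_left_mono) (auto simp: b_def)
    also have "\<dots> = (b * (1 / (8 * real m)) ^ (m - 1)) ^ s
        * ((N\<^sup>2) ^ (m - 1) * expect mu n (\<lambda>x. (LS S g x)\<^sup>2))"
      unfolding q_def power_mult_distrib by (simp add: mult_ac flip: power_mult)
    also have "\<dots> \<le> 1 * ((N\<^sup>2) ^ (m - 1) * expect mu n (\<lambda>x. (LS S g x)\<^sup>2))"
      using small by (intro mult_right_mono power_le_one) (auto simp: b_def expect_nonneg)
    finally show "b ^ card S *
      expect mu n (\<lambda>x. (ES ({} \<union> ({..<n} - S)) (\<lambda>y. (LS S g y)\<^sup>2) x) ^ m)
      \<le> (N\<^sup>2) ^ (m - 1) * expect mu n (\<lambda>x. (LS S g x)\<^sup>2)"
      by (simp add: s_def V_def)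
  qed
  also have "\<dots> = (N\<^sup>2) ^ (m - 1) * (2 ^ j * N\<^sup>2)"
    unfolding sum_distrib_left[symmetric] g_def sum_expect_LS_flevel N2 ..
  also have "\<dots> = 2 ^ j * (N\<^sup>2) ^ m"
    using m by (cases m) auto
  finally have "(\<rho> ^ (2 * j)) ^ m * expect mu n (\<lambda>x. (g x) ^ (2 * m)) \<le> 2 ^ j * (N\<^sup>2) ^ m"
    by (simp add: expect_scale)
  moreover have "(\<rho> ^ (2 * j)) ^ m = 1 / (16 * real m) ^ (j * m)"
    by (simp add: power_mult \<rho>2 power_divide)
  ultimately have "expect mu n (\<lambda>x. (g x) ^ (2 * m)) \<le> (16 * real m) ^ (j * m) * (2 ^ j * (N\<^sup>2) ^ m)"
    using m0 pos_divide_le_eq[of "(16 * real m) ^ (j * m)"] by (simp add: mult.commute)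
  \<comment> \<open>The 32 in \<open>P\<close> is 16 from \<open>\<rho>\<close> times 2 from the
    number of subsets, after raising \<open>2^j\<close> to \<open>2^(j m)\<close>.\<close>
  also have "\<dots> \<le> (16 * real m) ^ (j * m) * (2 ^ (j * m) * (N\<^sup>2) ^ m)"
    using m by (intro mult_left_mono mult_right_mono power_increasing) auto
  also have "\<dots> = (16 * real m * 2) ^ (j * m) * (N\<^sup>2) ^ m"
    by (simp only: power_mult_distrib mult.assoc)
  also have "16 * real m * 2 = 32 * real m * 1" by simp
  also have "(32 * real m * 1) ^ (j * m) * (N\<^sup>2) ^ m \<le> (32 * real m * r\<^sup>2) ^ (j * m) * (N\<^sup>2) ^ m"
    using r by (intro mult_right_mono power_mono mult_left_mono one_le_power) auto
  also have "\<dots> = ((N * P ^ j) ^ m)\<^sup>2"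
    unfolding P[symmetric] power_mult_distrib power_mult[symmetric] by (simp add: mult_ac)
  finally show ?thesis by (simp add: g_def)
qed

text \<open>The parameter \<open>m\<close>, and hence the loss \<open>K\<close> from interpolating between the first and second
  moments, stays fixed while the level decreases; this makes the bounds for the derivatives
  scale exactly geometrically in the order of the derivative.\<close>

lemma norm2_flevel_le:
  assumes m: "m \<ge> 2" and r: "1 \<le> r" and K: "0 < K" and P: "P = sqrt (32 * real m) * r"
  shows "global n j r \<gamma>1 \<gamma>2 f \<Longrightarrow> 0 < \<gamma>1 \<Longrightarrow> 0 \<le> \<gamma>2 \<Longrightarrow> \<gamma>2 \<le> \<gamma>1 * K ^ m
    \<Longrightarrow> norm2 mu n (flevel mu n j f) \<le> 2 * K * \<gamma>1 * P ^ j"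
proof (induction j arbitrary: f \<gamma>1 \<gamma>2 rule: less_induct)
  case (less j)
  note glob = less.prems(1) and \<gamma>1 = less.prems(2) and \<gamma>2 = less.prems(3) and \<gamma>K = less.prems(4)
  have P2: "P\<^sup>2 = 32 * real m * r\<^sup>2" and P0: "P > 0"
    using m r by (simp_all add: P power_mult_distrib)
  define g where "g = flevel mu n j f"
  define N where "N = norm2 mu n g"
  have N2: "N\<^sup>2 = expect mu n (\<lambda>x. (g x)\<^sup>2)" by (simp add: N_def norm2_sq)
  show ?case
  proof (rule ccontr)
    assume "\<not> ?thesis"
    \<comment> \<open>The negated claim bounds \<open>2 K \<gamma>1 P^j\<close> by \<open>N\<close>,
      so the induction hypothesis can be stated relative to \<open>N\<close>, as the moment bound
      demands.\<close>
    then have big: "2 * K * \<gamma>1 * P ^ j < N" by (simp add: N_def g_def)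
    have "0 < 2 * K * \<gamma>1 * P ^ j" using K \<gamma>1 P0 by simp
    with big have N0: "N > 0" by linarith
    have deriv: "expect mu n (\<lambda>y. (restr (LS S g) S x y)\<^sup>2) \<le> N\<^sup>2 * (1 / (8 * real m)) ^ card S"
      if S: "S \<subseteq> {..<n}" for S x
    proof -
      have fin: "finite S" using S finite_subset by blast
      consider "S = {}" | "S \<noteq> {}" "card S \<le> j" | "j < card S" by linarith
      then show ?thesis
      proof cases
        case 1
        then show ?thesis by (simp add: N2)
      next
        case 2
        define s where "s = card S"
        have s: "0 < s" "s \<le> j" using 2 fin by (auto simp: s_def card_gt_0_iff)
        have glob': "global n (j - s) r ((2 * r) ^ s * \<gamma>1) ((2 * r) ^ s * \<gamma>2) (restr (LS S f) S x)"
          using global_derivative[OF glob S] 2 r \<gamma>1 \<gamma>2 by (simp add: s_def)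
        have "(2 * r) ^ s * \<gamma>2 \<le> (2 * r) ^ s * \<gamma>1 * K ^ m"
          using \<gamma>K r by (simp add: mult.assoc)
        then have "norm2 mu n (flevel mu n (j - s) (restr (LS S f) S x))
            \<le> 2 * K * ((2 * r) ^ s * \<gamma>1) * P ^ (j - s)"
          using s r \<gamma>1 \<gamma>2 by (intro less.IH[OF _ glob']) auto
        then have "norm2 mu n (restr (LS S g) S x) \<le> 2 * K * ((2 * r) ^ s * \<gamma>1) * P ^ (j - s)"
          using derivative_flevel[OF S 2(2)] by (simp add: g_def s_def)
        \<comment> \<open>A derivative of order \<open>s\<close> gains \<open>(2 r)^s\<close> from
          the scaled bounds and loses \<open>P^s\<close> from the lower level; the square of
          \<open>2 r / P\<close> is exactly \<open>1 / (8 m)\<close>.\<close>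
        also have "\<dots> = (2 * K * \<gamma>1 * P ^ j) * (2 * r / P) ^ s"
          using s P0 by (simp add: power_diff power_divide)
        also have "\<dots> \<le> N * (2 * r / P) ^ s"
          using big r P0 by (intro mult_right_mono) auto
        finally have "(norm2 mu n (restr (LS S g) S x))\<^sup>2 \<le> (N * (2 * r / P) ^ s)\<^sup>2"
          by (intro power_mono norm2_nonneg)
        also have "\<dots> = N\<^sup>2 * ((2 * r / P)\<^sup>2) ^ s"
          by (simp add: power_mult_distrib mult.commute flip: power_mult)
        also have "(2 * r / P)\<^sup>2 = 1 / (8 * real m)"
          using r m by (simp add: power_divide P2 power_mult_distrib)
        finally show ?thesis by (simp add: norm2_sq s_def)
      next
        case 3
        have none: "{T. T \<subseteq> {..<n} \<and> card T = j \<and> S \<subseteq> T} = {}"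
        proof -
          have "\<not> S \<subseteq> T" if "T \<subseteq> {..<n}" "card T = j" for T
            using card_mono[of T S] that 3 finite_subset[of T "{..<n}"] by auto
          then show ?thesis by blast
        qed
        have "LS S g = (\<lambda>x. 0)"
          unfolding g_def LS_flevel[OF S] none by simp
        then show ?thesis by (simp add: restr_def)
      qed
    qed
    define Q where "Q = N * P ^ j"
    have Q0: "Q > 0" using N0 P0 by (simp add: Q_def)
    have moment: "expect mu n (\<lambda>x. (g x) ^ (2 * m)) \<le> (Q ^ m)\<^sup>2"
      unfolding g_def Q_def
      using m r N0 P2 N2 deriv unfolding g_def by (intro moment_flevel_bound) auto
    have f1: "expect mu n (\<lambda>x. \<bar>f x\<bar>) \<le> \<gamma>1" and f2: "expect mu n (\<lambda>x. (f x)\<^sup>2) \<le> \<gamma>2\<^sup>2"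
      using glob[unfolded global_def, rule_format, of "{}"] by simp_all
    have fg: "expect mu n (\<lambda>x. \<bar>f x\<bar> * \<bar>g x\<bar> ^ m) \<le> \<gamma>2 * Q ^ m"
    proof (rule power2_le_imp_le)
      have "(expect mu n (\<lambda>x. \<bar>f x\<bar> * \<bar>g x\<bar> ^ m))\<^sup>2
          \<le> expect mu n (\<lambda>x. \<bar>f x\<bar>\<^sup>2) * expect mu n (\<lambda>x. (\<bar>g x\<bar> ^ m)\<^sup>2)"
        by (rule expect_Cauchy_Schwarz)
      also have "\<dots> = expect mu n (\<lambda>x. (f x)\<^sup>2) * expect mu n (\<lambda>x. (g x) ^ (2 * m))"
        by (simp add: power_even_abs mult.commute[of m] flip: power_mult)
      also have "\<dots> \<le> \<gamma>2\<^sup>2 * (Q ^ m)\<^sup>2"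
        using f2 moment by (intro mult_mono) (auto intro!: expect_nonneg)
      finally show "(expect mu n (\<lambda>x. \<bar>f x\<bar> * \<bar>g x\<bar> ^ m))\<^sup>2 \<le> (\<gamma>2 * Q ^ m)\<^sup>2"
        by (simp add: power_mult_distrib)
    qed (use \<gamma>2 Q0 in simp)
    \<comment> \<open>With this threshold the two bounds from the truncation are equal, each being
      \<open>\<tau> \<gamma>1\<close>. Their sum \<open>2 Q K \<gamma>1\<close> is \<open>N\<close>
      times the claimed bound, which contradicts \<open>big\<close>.\<close>
    define \<tau> where "\<tau> = Q * K"
    have \<tau>0: "\<tau> > 0" using Q0 K by (simp add: \<tau>_def)
    have "N\<^sup>2 = expect mu n (\<lambda>x. f x * g x)"
      by (simp add: N2 g_def expect_mult_flevel)
    also have "\<dots> \<le> expect mu n (\<lambda>x. \<tau> * \<bar>f x\<bar> + (1 / \<tau> ^ (m - 1)) * (\<bar>f x\<bar> * \<bar>g x\<bar> ^ m))"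
      using m by (intro expect_mono abs_mult_le_truncation \<tau>0) simp
    also have "\<dots> = \<tau> * expect mu n (\<lambda>x. \<bar>f x\<bar>)
        + (1 / \<tau> ^ (m - 1)) * expect mu n (\<lambda>x. \<bar>f x\<bar> * \<bar>g x\<bar> ^ m)"
      by (simp only: expect_add expect_scale)
    also have "\<dots> \<le> \<tau> * \<gamma>1 + (1 / \<tau> ^ (m - 1)) * ((\<gamma>1 * K ^ m) * Q ^ m)"
    proof -
      have "\<gamma>2 * Q ^ m \<le> (\<gamma>1 * K ^ m) * Q ^ m"
        using \<gamma>K Q0 by (intro mult_right_mono) auto
      then show ?thesis
        using f1 fg \<tau>0 by (intro add_mono mult_left_mono) auto
    qed
    also have "(1 / \<tau> ^ (m - 1)) * ((\<gamma>1 * K ^ m) * Q ^ m) = \<tau> * \<gamma>1"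
      using m \<tau>0 Q0 K by (cases m) (auto simp: \<tau>_def power_mult_distrib)
    finally have "N * N \<le> N * (2 * K * \<gamma>1 * P ^ j)"
      by (simp add: \<tau>_def Q_def power2_eq_square mult_ac)
    then show False using big N0 by simp
  qed
qed

text \<open>The part of level zero is the constant \<open>expect mu n f\<close>, whose absolute
  value is at most the first norm.\<close>

lemma norm2_flevel_0_le: "norm2 mu n (flevel mu n 0 f) \<le> norm1 mu n f"
proof -
  have *: "{T. T \<subseteq> {..<n} \<and> card T = 0} = {{}}"
    by (auto simp: card_eq_0_iff finite_subset)
  have "flevel mu n 0 f = ES {..<n} f"
    by (simp add: flevel_def * fpart_eq)
  moreover have "ES {..<n} f x = expect mu n f" if "x \<in> PiE {..<n} (\<lambda>_. UNIV)" for x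
    using expect_restr[OF _ that, of "{}" f] by simp
  ultimately have "expect mu n (\<lambda>x. (flevel mu n 0 f x)\<^sup>2) \<le> expect mu n (\<lambda>x. (expect mu n f)\<^sup>2)"
    by (intro expect_mono_PiE) simp
  then have "norm2 mu n (flevel mu n 0 f) \<le> \<bar>expect mu n f\<bar>"
    by (simp add: norm2_def real_le_lsqrt real_sqrt_le_iff flip: real_sqrt_abs)
  also have "\<dots> \<le> norm1 mu n f"
  proof -
    have "expect mu n f \<le> norm1 mu n f" "expect mu n (\<lambda>x. (- 1) * f x) \<le> norm1 mu n f"
      unfolding norm1_def by (intro expect_mono, simp)+
    then show ?thesis unfolding expect_scale by simp
  qed
  finally show ?thesis .
qed

end

theorem mainTheorem4:
  fixes mu :: "'a::finite \<Rightarrow> real"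
    and f :: "(nat \<Rightarrow> 'a) \<Rightarrow> real"
    and n d :: nat
    and \<gamma>1 \<gamma>2 r :: real
  assumes "prob_weights mu"
    and "0 < \<gamma>1" and "\<gamma>1 < \<gamma>2" and "1 < r"
    and "real d \<le> ln (\<gamma>2 / \<gamma>1) / 2"
    and "\<And>S x. S \<subseteq> {..<n} \<Longrightarrow> card S \<le> d \<Longrightarrow>
           norm1 mu n (restr f S x) \<le> r ^ card S * \<gamma>1"
    and "\<And>S x. S \<subseteq> {..<n} \<Longrightarrow> card S \<le> d \<Longrightarrow>
           norm2 mu n (restr f S x) \<le> r ^ card S * \<gamma>2"
  shows "(norm2 mu n (flevel mu n d f))\<^sup>2
           \<le> \<gamma>1\<^sup>2 * (2200 * r\<^sup>2 * ln (\<gamma>2 / \<gamma>1) / real d) ^ d"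
proof -
  interpret finite_prob mu by standard (rule assms(1))
  define \<l> where "\<l> = ln (\<gamma>2 / \<gamma>1)"
  show ?thesis
  proof (cases "d = 0")
    case True
    have "norm2 mu n (flevel mu n 0 f) \<le> \<gamma>1"
      using norm2_flevel_0_le[of n f] assms(6)[of "{}"] by simp
    then have "(norm2 mu n (flevel mu n 0 f))\<^sup>2 \<le> \<gamma>1\<^sup>2"
      by (intro power_mono norm2_nonneg)
    \<comment> \<open>Division by zero gives zero here, and the exponent 0 makes the last factor
      1.\<close>
    then show ?thesis using True by simp
  next
    case False
    \<comment> \<open>The exponent \<open>m\<close> is \<open>a\<close> rounded up. The assumption
      on \<open>d\<close> gives \<open>a \<ge> 2\<close>, so rounding loses at most a factor
      3/2.\<close>
    define a where "a = \<l> / real d"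
    define m where "m = nat \<lceil>a\<rceil>"
    define P where "P = sqrt (32 * real m) * r"
    have a: "a \<ge> 2" using assms(5) False by (simp add: a_def \<l>_def field_simps)
    have m: "m \<ge> 2" using a by (simp add: m_def le_nat_iff)
    have ma: "a \<le> real m" "real m \<le> 3 / 2 * a"
      using a unfolding m_def by linarith+
    have glob: "global n d r \<gamma>1 \<gamma>2 f"
      unfolding global_def
    proof (intro allI impI conjI)
      fix S x assume S: "S \<subseteq> {..<n}" "card S \<le> d"
      show "expect mu n (\<lambda>y. \<bar>restr f S x y\<bar>) \<le> r ^ card S * \<gamma>1"
        using assms(6)[OF S, of x] by (simp add: norm1_def)
      show "expect mu n (\<lambda>y. (restr f S x y)\<^sup>2) \<le> (r ^ card S * \<gamma>2)\<^sup>2"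
        using power_mono[OF assms(7)[OF S, of x] norm2_nonneg, of 2] by (simp add: norm2_sq)
    qed
    \<comment> \<open>The interpolation loss is \<open>K = exp d\<close>: since \<open>m d\<close>
      is at least \<open>ln (\<gamma>2 / \<gamma>1)\<close>, its \<open>m\<close>-th power covers
      the ratio of the two bounds.\<close>
    have "\<gamma>2 \<le> \<gamma>1 * exp (real d) ^ m"
    proof -
      have "\<gamma>2 / \<gamma>1 = exp \<l>" using assms(2,3) by (simp add: \<l>_def)
      also have "\<dots> \<le> exp (real m * real d)"
        using ma(1) False by (simp add: a_def field_simps)
      also have "\<dots> = exp (real d) ^ m" by (rule exp_of_nat_mult)
      finally show ?thesis using assms(2) by (simp add: pos_divide_le_eq mult.commute)
    qed
    then have "norm2 mu n (flevel mu n d f) \<le> 2 * exp (real d) * \<gamma>1 * P ^ d"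
      using m assms(2-4) glob by (intro norm2_flevel_le[OF m _ _ P_def]) auto
    then have "(norm2 mu n (flevel mu n d f))\<^sup>2 \<le> (2 * exp (real d) * \<gamma>1 * P ^ d)\<^sup>2"
      by (intro power_mono norm2_nonneg)
    also have "\<dots> = \<gamma>1\<^sup>2 * (4 * ((exp 1)\<^sup>2 * P\<^sup>2) ^ d)"
    proof -
      have "exp (real d) = exp 1 ^ d" using exp_of_nat_mult[of d 1] by simp
      then show ?thesis by (simp add: power_mult_distrib mult_ac flip: power_mult)
    qed
    also have "\<dots> \<le> \<gamma>1\<^sup>2 * (2200 * r\<^sup>2 * a) ^ d"
    proof (rule mult_left_mono)
      \<comment> \<open>The constants multiply to \<open>9 * 32 * 3/2 = 432\<close>; the leading 4
        is absorbed as \<open>4^d\<close> because \<open>d > 0\<close>, giving 1728, below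
        2200.\<close>
      have e: "(exp 1 :: real)\<^sup>2 \<le> 3\<^sup>2" using exp_le by (intro power_mono) auto
      have "(exp 1)\<^sup>2 * P\<^sup>2 \<le> 9 * (32 * (3 / 2 * a) * r\<^sup>2)"
        using e ma m unfolding P_def power_mult_distrib
        by (intro mult_mono) auto
      then have "((exp 1)\<^sup>2 * P\<^sup>2) ^ d \<le> (432 * a * r\<^sup>2) ^ d"
        by (intro power_mono) auto
      moreover have "(4 :: real) ^ 1 \<le> 4 ^ d" using False by (intro power_increasing) auto
      ultimately have "4 * ((exp 1)\<^sup>2 * P\<^sup>2) ^ d \<le> 4 ^ d * (432 * a * r\<^sup>2) ^ d"
        by (intro mult_mono) auto
      also have "\<dots> = (1728 * r\<^sup>2 * a) ^ d" by (simp add: mult_ac flip: power_mult_distrib)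
      also have "\<dots> \<le> (2200 * r\<^sup>2 * a) ^ d" using a by (intro power_mono mult_right_mono) auto
      finally show "4 * ((exp 1)\<^sup>2 * P\<^sup>2) ^ d \<le> (2200 * r\<^sup>2 * a) ^ d" .
    qed simp
    finally show ?thesis by (simp add: a_def \<l>_def)
  qed
qed

end
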